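(* Let $E$ be an arbitrary directed graph, $K$ a field, and let $I$ be a proper two-sided ideal of the Leavitt path algebra $L_K(E)$ of $E$ over $K$. Then $\bigcap_{n=1}^{\infty}I^n=0$ if and only if $I$ contains no vertices of $E$.
   Context: A directed graph $E=(E^0,E^1,r,s)$ consists of sets $E^0$ (vertices) and $E^1$ (edges), of arbitrary cardinality, with maps $r,s:E^1\to E^0$ (range, source). A vertex $v$ is regular if $s^{-1}(v)$ is finite and non-empty. The Leavitt path algebra $L_K(E)$ is the (not necessarily unital) $K$-algebra generated by pairwise orthogonal idempotents $\{v:v\in E^0\}$ and elements $\{e,e^*:e\in E^1\}$ subject to: (1) $s(e)e=e=er(e)$; (2) $r(e)e^*=e^*=e^*s(e)$; (3) $e^*e=r(e)$ and $e^*f=0$ for edges $e\ne f$; (4) $v=\sum_{s(e)=v}ee^*$ for every regular vertex $v$. "$I$ contains no vertices" means $I\cap E^0=\emptyset$, with vertices viewed as elements of $L_K(E)$. *)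

theory Defs
  imports
    "Graph_Theory.Digraph"
    "HOL-Algebra.QuotRing"
    "HOL-Algebra.Ideal_Product"
    "HOL-Library.Poly_Mapping"
begin

text \<open>
  A directed graph is a well-formed \<open>pre_digraph\<close>: vertices and edges are carrier sets of
  arbitrary cardinality, loops and parallel edges are allowed, and \<^term>\<open>tail E\<close> and
  \<^term>\<open>head E\<close> are the source map \<open>s\<close> and the range map \<open>r\<close>.
\<close>

definition regular_vertex :: "('v, 'e) pre_digraph \<Rightarrow> 'v \<Rightarrow> bool" where
  "regular_vertex E v \<longleftrightarrow> v \<in> verts E \<and> finite (out_arcs E v) \<and> out_arcs E v \<noteq> {}"

section \<open>The free algebra on the generators\<close>

text \<open>
  The free monoid needs a type of its own, since \<open>monoid_add\<close> is the class that turns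
  \<open>poly_mapping\<close> into a convolution algebra.
\<close>

datatype 'g word = Word (letters: "'g list")

instantiation word :: (type) monoid_add
begin

definition zero_word :: "'a word" where
  "0 = Word []"

definition plus_word :: "'a word \<Rightarrow> 'a word \<Rightarrow> 'a word" where
  "u + w = Word (letters u @ letters w)"

instance
  by standard (simp_all add: zero_word_def plus_word_def)

end

datatype ('v, 'e) generator = Vertex 'v | Edge 'e | Ghost 'e

type_synonym ('v, 'e, 'k) free_alg = "('v, 'e) generator word \<Rightarrow>\<^sub>0 'k"

definition generators :: "('v, 'e) pre_digraph \<Rightarrow> ('v, 'e) generator set" where
  "generators E = Vertex ` verts E \<union> Edge ` arcs E \<union> Ghost ` arcs E"

text \<open>
  The free non-unital algebra: noncommutative polynomials in the generators without constant
  term. The element \<open>1\<close> in the record does not belong to the carrier; the field is only there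
  because HOL-Algebra's ring records have it.
\<close>

definition free_algebra :: "('v, 'e) pre_digraph \<Rightarrow> ('v, 'e, 'k::field) free_alg ring" where
  "free_algebra E =
     \<lparr>carrier = {p. \<forall>w \<in> Poly_Mapping.keys p. w \<noteq> 0 \<and> set (letters w) \<subseteq> generators E},
      mult = (*), one = 1, zero = 0, add = (+)\<rparr>"

definition gen :: "('v, 'e) generator \<Rightarrow> ('v, 'e, 'k::field) free_alg" where
  "gen g = Poly_Mapping.single (Word [g]) 1"

abbreviation vtx :: "'v \<Rightarrow> ('v, 'e, 'k::field) free_alg" where
  "vtx v \<equiv> gen (Vertex v)"

abbreviation edge :: "'e \<Rightarrow> ('v, 'e, 'k::field) free_alg" where
  "edge e \<equiv> gen (Edge e)"

abbreviation ghost :: "'e \<Rightarrow> ('v, 'e, 'k::field) free_alg" where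
  "ghost e \<equiv> gen (Ghost e)"

section \<open>The Leavitt path algebra\<close>

text \<open>A relation \<open>a = b\<close> of the presentation is represented by \<open>a - b\<close>.\<close>

inductive_set lpa_relators :: "('v, 'e) pre_digraph \<Rightarrow> ('v, 'e, 'k::field) free_alg set"
  for E where
  vertex_idem: "v \<in> verts E \<Longrightarrow> vtx v * vtx v - vtx v \<in> lpa_relators E"
| vertex_orth: "\<lbrakk>v \<in> verts E; w \<in> verts E; v \<noteq> w\<rbrakk> \<Longrightarrow> vtx v * vtx w \<in> lpa_relators E"
| source_edge: "e \<in> arcs E \<Longrightarrow> vtx (tail E e) * edge e - edge e \<in> lpa_relators E"
| edge_range: "e \<in> arcs E \<Longrightarrow> edge e * vtx (head E e) - edge e \<in> lpa_relators E"
| range_ghost: "e \<in> arcs E \<Longrightarrow> vtx (head E e) * ghost e - ghost e \<in> lpa_relators E"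
| ghost_source: "e \<in> arcs E \<Longrightarrow> ghost e * vtx (tail E e) - ghost e \<in> lpa_relators E"
| ghost_edge: "e \<in> arcs E \<Longrightarrow> ghost e * edge e - vtx (head E e) \<in> lpa_relators E"
| ghost_edge_orth: "\<lbrakk>e \<in> arcs E; f \<in> arcs E; e \<noteq> f\<rbrakk> \<Longrightarrow> ghost e * edge f \<in> lpa_relators E"
| regular: "regular_vertex E v \<Longrightarrow>
    vtx v - (\<Sum>e \<in> out_arcs E v. edge e * ghost e) \<in> lpa_relators E"

text \<open>
  The algebra ideal of \<open>free_algebra E\<close> generated by the relators. Multiplication by
  \<open>Poly_Mapping.single 0 c\<close> is multiplication by the scalar \<open>c\<close>.
\<close>

inductive_set lpa_ideal :: "('v, 'e) pre_digraph \<Rightarrow> ('v, 'e, 'k::field) free_alg set"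
  for E where
  zero: "0 \<in> lpa_ideal E"
| relator: "p \<in> lpa_relators E \<Longrightarrow> p \<in> lpa_ideal E"
| add: "\<lbrakk>p \<in> lpa_ideal E; q \<in> lpa_ideal E\<rbrakk> \<Longrightarrow> p + q \<in> lpa_ideal E"
| scale: "p \<in> lpa_ideal E \<Longrightarrow> Poly_Mapping.single 0 c * p \<in> lpa_ideal E"
| lmult: "\<lbrakk>p \<in> lpa_ideal E; a \<in> carrier (free_algebra E)\<rbrakk> \<Longrightarrow> a * p \<in> lpa_ideal E"
| rmult: "\<lbrakk>p \<in> lpa_ideal E; a \<in> carrier (free_algebra E)\<rbrakk> \<Longrightarrow> p * a \<in> lpa_ideal E"

type_synonym ('v, 'e, 'k) lpa = "('v, 'e, 'k) free_alg set"

text \<open>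
  In general \<open>leavitt_path_algebra E\<close> has no identity (it has one iff \<open>E\<close> has finitely many
  vertices), so the \<open>one\<close> field of the quotient record is meaningless.
\<close>

definition leavitt_path_algebra :: "('v, 'e) pre_digraph \<Rightarrow> ('v, 'e, 'k::field) lpa ring" where
  "leavitt_path_algebra E = free_algebra E Quot lpa_ideal E"

definition lpa_vertex :: "('v, 'e) pre_digraph \<Rightarrow> 'v \<Rightarrow> ('v, 'e, 'k::field) lpa" where
  "lpa_vertex E v = lpa_ideal E +>\<^bsub>free_algebra E\<^esub> vtx v"

section \<open>Ideals of non-unital rings\<close>

text \<open>
  The locale \<open>ideal\<close> of HOL-Algebra presupposes a unital ring. No closure under scalars is
  demanded: for Leavitt path algebras it is automatic because of local units.
\<close>

definition two_sided_ideal :: "'a set \<Rightarrow> ('a, 'b) ring_scheme \<Rightarrow> bool" where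
  "two_sided_ideal I R \<longleftrightarrow> additive_subgroup I R \<and>
     (\<forall>a \<in> I. \<forall>x \<in> carrier R. x \<otimes>\<^bsub>R\<^esub> a \<in> I \<and> a \<otimes>\<^bsub>R\<^esub> x \<in> I)"

fun ideal_power :: "('a, 'b) ring_scheme \<Rightarrow> 'a set \<Rightarrow> nat \<Rightarrow> 'a set" where
  "ideal_power R I 0 = carrier R"
| "ideal_power R I (Suc 0) = I"
| "ideal_power R I (Suc (Suc n)) = ideal_prod R (ideal_power R I (Suc n)) I"

end

theory Submission
  imports
    Defs
    "Graph_Theory.Arc_Walk"
    "HOL-Library.Sublist"
    "HOL-Computational_Algebra.Polynomial"
begin

text \<open>
  A vertex in \<open>I\<close> is a nonzero idempotent and hence lies in every power of \<open>I\<close>.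

  Conversely let \<open>x \<noteq> 0\<close> lie in all powers of an ideal \<open>I\<close> without vertices. Multiplying \<open>x\<close> by
  paths from the right removes all ghost edges; cancelling a shortest path on the left leaves
  \<open>z = k v + \<Sum> k\<^sub>i \<gamma>\<^sub>i\<close> with \<open>k \<noteq> 0\<close> and nontrivial closed paths \<open>\<gamma>\<^sub>i\<close> at \<open>v\<close>. If some path \<open>\<mu>\<close> from \<open>v\<close>
  is not an initial piece of \<open>\<gamma>\<^sub>i \<gamma>\<^sub>i \<dots>\<close>, then \<open>\<mu>\<^sup>* z \<mu>\<close> has the same shape with fewer terms; no term
  \<open>\<gamma>\<^sub>i\<close> at all would mean \<open>v \<in> I\<close>. So eventually \<open>v\<close> lies on a cycle \<open>c\<close> without exits, \<open>z = p(c)\<close>, and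
  \<open>L v\<close> is free over \<open>v L v = K[c, c\<^sup>*]\<close> on the paths into \<open>v\<close> that do not end with \<open>c\<close>. If \<open>f\<close> generates
  the ideal of polynomials \<open>g\<close> with \<open>g(c) \<in> I\<close>, then \<open>I\<^sup>n v \<subseteq> L f(c)\<^sup>n\<close>, so \<open>f\<^sup>n\<close> divides \<open>p\<close> for all
  \<open>n\<close>. Hence \<open>f\<close> is constant, and again \<open>v \<in> I\<close>.
\<close>

section \<open>Leavitt families\<close>

text \<open>All reductions multiply by elements of the algebra, so they can be run inside the
  intersection of the powers, which is itself an ideal; this is why one and the same element z lies
  in every power. Wherever something has to be nonzero, the argument rests on a fact that cannot be
  read off from the relations: distinct paths with the same ends are linearly independent. The
  locale \<open>leavitt_family\<close> assumes it, and a representation of the algebra on functions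
  provides it later. The corner at \<open>v\<close> consists of Laurent polynomials, yet only
  ordinary polynomials are evaluated. Multiplying by a high power of c clears its inverse powers, at
  the price that divisibility is first obtained for p times a power of the variable. That power can
  be cancelled again: f divides p, and p has the nonzero constant term k, so f is prime to the
  variable.\<close>

lemma (in wf_digraph) awalk_append_ex:
  "awalk u (p @ q) w \<longleftrightarrow> (\<exists>v. awalk u p v \<and> awalk v q w)"
  by (metis awalk_append_iff awalkE')

text \<open>The ring type has a unit, although the algebra generated by the family need not contain
  it; the scalars and the empty product live there. All axioms except the last still hold when
  \<open>V\<close>, \<open>S\<close> and \<open>T\<close> vanish, so
  \<open>walks_independent\<close> is what excludes collapse.\<close>

locale leavitt_family = wf_digraph E
  for E :: "('v, 'e) pre_digraph" +
  fixes C :: "'k::field \<Rightarrow> 'r::{ring,monoid_mult}"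
    and V :: "'v \<Rightarrow> 'r" and S T :: "'e \<Rightarrow> 'r"
  assumes C_add: "C (a + b) = C a + C b"
    and C_mult: "C (a * b) = C a * C b"
    and C_one: "C 1 = 1"
    and C_commute: "C a * x = x * C a"
    and V_idem: "v \<in> verts E \<Longrightarrow> V v * V v = V v"
    and V_orth: "\<lbrakk>v \<in> verts E; w \<in> verts E; v \<noteq> w\<rbrakk> \<Longrightarrow> V v * V w = 0"
    and V_S: "e \<in> arcs E \<Longrightarrow> V (tail E e) * S e = S e"
    and S_V: "e \<in> arcs E \<Longrightarrow> S e * V (head E e) = S e"
    and V_T: "e \<in> arcs E \<Longrightarrow> V (head E e) * T e = T e"
    and T_V: "e \<in> arcs E \<Longrightarrow> T e * V (tail E e) = T e"
    and T_S: "e \<in> arcs E \<Longrightarrow> T e * S e = V (head E e)"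
    and T_S_orth: "\<lbrakk>e \<in> arcs E; f \<in> arcs E; e \<noteq> f\<rbrakk> \<Longrightarrow> T e * S f = 0"
    and V_regular: "regular_vertex E v \<Longrightarrow> V v = (\<Sum>e\<in>out_arcs E v. S e * T e)"
    and walks_independent: "\<lbrakk>finite A; \<And>es. es \<in> A \<Longrightarrow> awalk u es v;
      (\<Sum>es\<in>A. C (k es) * (V u * prod_list (map S es))) = 0; es \<in> A\<rbrakk> \<Longrightarrow> k es = 0"
begin

text \<open>This rule describes the middle vertex as the last vertex of the first walk; the
  existential form \<open>awalk_append_ex\<close> combines better with walks whose ends are
  known.\<close>

declare awalk_append_iff [simp del]

section \<open>Arithmetic of paths and ghost paths\<close>

lemma C_zero [simp]: "C 0 = 0"
  using C_add[of 0 0] by simp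

lemma C_left_commute: "x * (C a * y) = C a * (x * y)"
  by (metis C_commute mult.assoc)

text \<open>The factor \<open>V u\<close> makes the empty walk stand for the vertex \<open>u\<close>
  and not for the unit of the ring.\<close>

definition path :: "'v \<Rightarrow> 'e list \<Rightarrow> 'r" where
  "path u es = V u * prod_list (map S es)"

text \<open>The adjoint of \<open>path u es\<close>, usually written with a star; taking adjoints
  reverses products.\<close>

definition copath :: "'v \<Rightarrow> 'e list \<Rightarrow> 'r" where
  "copath u es = prod_list (map T (rev es)) * V u"

lemma path_Nil [simp]: "path u [] = V u"
  and copath_Nil [simp]: "copath u [] = V u"
  by (simp_all add: path_def copath_def)

lemma path_Cons: "e \<in> arcs E \<Longrightarrow> path (tail E e) (e # es) = S e * path (head E e) es"
  unfolding path_def by (simp flip: mult.assoc add: V_S S_V)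

lemma copath_Cons: "e \<in> arcs E \<Longrightarrow> copath (tail E e) (e # es) = copath (head E e) es * T e"
  unfolding copath_def by (simp add: mult.assoc V_T T_V)

lemma V_path: "u \<in> verts E \<Longrightarrow> V u * path u es = path u es"
  unfolding path_def by (simp flip: mult.assoc add: V_idem)

lemma copath_V: "u \<in> verts E \<Longrightarrow> copath u es * V u = copath u es"
  unfolding copath_def by (simp add: mult.assoc V_idem)

lemma V_path_neq: "\<lbrakk>u \<in> verts E; w \<in> verts E; w \<noteq> u\<rbrakk> \<Longrightarrow> V w * path u es = 0"
  unfolding path_def by (simp flip: mult.assoc add: V_orth)

lemma copath_V_neq: "\<lbrakk>u \<in> verts E; w \<in> verts E; w \<noteq> u\<rbrakk> \<Longrightarrow> copath u es * V w = 0"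
  unfolding copath_def by (simp add: mult.assoc V_orth)

lemma path_V: "awalk u es w \<Longrightarrow> path u es * V w = path u es"
proof (induction es arbitrary: u)
  case Nil
  then show ?case by (auto simp: awalk_Nil_iff V_idem)
next
  case (Cons e es)
  then have "e \<in> arcs E" "u = tail E e" "awalk (head E e) es w"
    by (simp_all add: awalk_Cons_iff)
  then show ?case using Cons.IH by (simp add: path_Cons mult.assoc)
qed

lemma V_copath: "awalk u es w \<Longrightarrow> V w * copath u es = copath u es"
proof (induction es arbitrary: u)
  case Nil
  then show ?case by (auto simp: awalk_Nil_iff V_idem)
next
  case (Cons e es)
  then have "e \<in> arcs E" "u = tail E e" "awalk (head E e) es w"
    by (simp_all add: awalk_Cons_iff)
  then show ?case using Cons.IH by (simp add: copath_Cons flip: mult.assoc)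
qed

lemma path_append: "awalk u es w \<Longrightarrow> path u (es @ fs) = path u es * path w fs"
  using path_V[of u es w] unfolding path_def by (simp flip: mult.assoc)

lemma copath_append: "awalk u es w \<Longrightarrow> copath u (es @ fs) = copath w fs * copath u es"
  using V_copath[of u es w] unfolding copath_def by (simp add: mult.assoc)

lemma path_single: "e \<in> arcs E \<Longrightarrow> path (tail E e) [e] = S e"
  by (simp add: path_Cons S_V)

lemma copath_single: "e \<in> arcs E \<Longrightarrow> copath (tail E e) [e] = T e"
  by (simp add: copath_Cons V_T)

lemma copath_path: "awalk u es w \<Longrightarrow> copath u es * path u es = V w"
proof (induction es arbitrary: u)
  case Nil
  then show ?case by (auto simp: awalk_Nil_iff V_idem)
next
  case (Cons e es)
  then have e: "e \<in> arcs E" "u = tail E e" "awalk (head E e) es w"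
    by (simp_all add: awalk_Cons_iff)
  have "copath u (e # es) * path u (e # es)
      = copath (head E e) es * ((T e * S e) * path (head E e) es)"
    using e by (simp add: path_Cons copath_Cons mult.assoc)
  also have "\<dots> = copath (head E e) es * path (head E e) es"
    using e by (simp add: T_S V_path)
  finally show ?case using Cons.IH[OF e(3)] by simp
qed

lemma copath_path_append:
  assumes "awalk u es w" "awalk w fs x"
  shows "copath u es * path u (es @ fs) = path w fs"
  using assms by (simp add: path_append[OF assms(1)] copath_path V_path awalk_hd_in_verts flip: mult.assoc)

text \<open>The common initial piece cancels edge by edge, and at the first place where the walks
  differ a factor \<open>T e * S f\<close> with distinct edges appears.\<close>

lemma copath_path_incomparable:
  assumes "awalk u es v" "awalk u fs w" "\<not> prefix es fs" "\<not> prefix fs es"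
  shows "copath u es * path u fs = 0"
  using assms
proof (induction es arbitrary: u fs)
  case (Cons e es)
  then have e: "e \<in> arcs E" "u = tail E e" "awalk (head E e) es v"
    by (simp_all add: awalk_Cons_iff)
  obtain f fs' where fs: "fs = f # fs'" using Cons.prems by (cases fs) auto
  then have f: "f \<in> arcs E" "u = tail E f" "awalk (head E f) fs' w"
    using Cons.prems by (simp_all add: awalk_Cons_iff)
  have "path u (f # fs') = S f * path (head E f) fs'"
    "copath u (e # es) = copath (head E e) es * T e"
    using path_Cons[OF f(1)] copath_Cons[OF e(1)] e f by simp_all
  then have eq: "copath u (e # es) * path u fs
      = copath (head E e) es * ((T e * S f) * path (head E f) fs')"
    using fs by (simp add: mult.assoc)
  show ?case
  proof (cases "e = f")
    case True
    then have "copath (head E e) es * path (head E e) fs' = 0"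
      using Cons.IH[OF e(3), of fs'] f fs Cons.prems by auto
    with True eq e show ?thesis by (simp add: T_S V_path)
  next
    case False
    with eq e f show ?thesis by (simp add: T_S_orth)
  qed
qed simp

lemma path_independent:
  assumes "finite A" "\<And>es. es \<in> A \<Longrightarrow> awalk u es v"
    "(\<Sum>es\<in>A. C (k es) * path u es) = 0" "es \<in> A"
  shows "k es = 0"
  using walks_independent[OF assms(1,2)] assms(3,4) by (simp add: path_def)

lemma V_nonzero: assumes "v \<in> verts E" shows "V v \<noteq> 0"
  using path_independent[of "{[]}" v v "\<lambda>_. 1" "[]"] assms by (auto simp: awalk_Nil_iff C_one)

section \<open>The non-unital algebra generated by the family and its spanning monomials\<close>

inductive_set alg :: "'r set" where
  zero: "0 \<in> alg"
| V: "v \<in> verts E \<Longrightarrow> V v \<in> alg"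
| S: "e \<in> arcs E \<Longrightarrow> S e \<in> alg"
| T: "e \<in> arcs E \<Longrightarrow> T e \<in> alg"
| add: "\<lbrakk>x \<in> alg; y \<in> alg\<rbrakk> \<Longrightarrow> x + y \<in> alg"
| mult: "\<lbrakk>x \<in> alg; y \<in> alg\<rbrakk> \<Longrightarrow> x * y \<in> alg"
| scale: "x \<in> alg \<Longrightarrow> C k * x \<in> alg"

lemma alg_sum: "(\<And>i. i \<in> A \<Longrightarrow> f i \<in> alg) \<Longrightarrow> sum f A \<in> alg"
  by (induction A rule: infinite_finite_induct) (auto intro: alg.intros)

lemma path_in_alg: "awalk u es w \<Longrightarrow> path u es \<in> alg"
  by (induction es arbitrary: u)
    (auto simp: awalk_Nil_iff awalk_Cons_iff path_Cons intro: alg.intros)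

lemma copath_in_alg: "awalk u es w \<Longrightarrow> copath u es \<in> alg"
  by (induction es arbitrary: u)
    (auto simp: awalk_Nil_iff awalk_Cons_iff copath_Cons intro: alg.intros)

inductive_set monomial_span :: "'r set" where
  zero: "0 \<in> monomial_span"
| monomial: "\<lbrakk>awalk u es w; awalk v fs w\<rbrakk> \<Longrightarrow> C k * (path u es * copath v fs) \<in> monomial_span"
| add: "\<lbrakk>x \<in> monomial_span; y \<in> monomial_span\<rbrakk> \<Longrightarrow> x + y \<in> monomial_span"

lemma path_copath_in_span: "\<lbrakk>awalk u es w; awalk v fs w\<rbrakk> \<Longrightarrow> path u es * copath v fs \<in> monomial_span"
  using monomial_span.monomial[of u es w v fs 1] by (simp add: C_one)

lemma monomial_span_linear:
  assumes "x \<in> monomial_span"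
    and "\<And>u es w v fs. \<lbrakk>awalk u es w; awalk v fs w\<rbrakk> \<Longrightarrow> a * (path u es * copath v fs) \<in> monomial_span"
    and "\<And>k y. y \<in> monomial_span \<Longrightarrow> C k * y \<in> monomial_span"
  shows "a * x \<in> monomial_span"
  using assms(1)
  by induction (simp_all add: distrib_left C_left_commute assms(2,3) monomial_span.intros)

lemma monomial_span_scale: "x \<in> monomial_span \<Longrightarrow> C k * x \<in> monomial_span"
proof (induction rule: monomial_span.induct)
  case (monomial u es w v fs l)
  then show ?case
    using monomial_span.monomial[OF monomial, of "k * l"] by (simp add: C_mult mult.assoc)
qed (auto simp: distrib_left intro: monomial_span.intros)

lemma monomial_span_lmult:
  assumes "a \<in> alg" "x \<in> monomial_span"
  shows "a * x \<in> monomial_span"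
  using assms
proof (induction arbitrary: x)
  case (V v)
  show ?case
  proof (rule monomial_span_linear[OF V(2) _ monomial_span_scale])
    fix u es w t fs assume m: "awalk u es w" "awalk t fs w"
    then show "V v * (path u es * copath t fs) \<in> monomial_span"
      using V by (cases "v = u")
        (simp_all add: V_path V_path_neq awalk_hd_in_verts path_copath_in_span monomial_span.zero flip: mult.assoc)
  qed
next
  case (S e)
  show ?case
  proof (rule monomial_span_linear[OF S(2) _ monomial_span_scale])
    fix u es w t fs assume m: "awalk u es w" "awalk t fs w"
    show "S e * (path u es * copath t fs) \<in> monomial_span"
    proof (cases "u = head E e")
      case True
      then have "awalk (tail E e) (e # es) w" using m S by (simp add: awalk_Cons_iff)
      from path_copath_in_span[OF this m(2)] show ?thesis
        using True S by (simp add: path_Cons mult.assoc)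
    next
      case False
      then have "S e * path u es = 0"
        using S m V_path_neq[of u "head E e" es]
        by (metis S_V awalk_hd_in_verts head_in_verts mult.assoc mult_zero_right)
      then show ?thesis by (simp add: monomial_span.zero flip: mult.assoc)
    qed
  qed
next
  case (T e)
  show ?case
  proof (rule monomial_span_linear[OF T(2) _ monomial_span_scale])
    fix u es w t fs assume m: "awalk u es w" "awalk t fs w"
    show "T e * (path u es * copath t fs) \<in> monomial_span"
    proof (cases "u = tail E e")
      case u: True
      show ?thesis
      proof (cases es)
        case Nil
        with m have "u = w" "w \<in> verts E" by (auto simp: awalk_Nil_iff)
        \<comment> \<open>With an empty real part nothing is left to cancel against
          \<open>T e\<close>; the ghost edge is absorbed by the ghost path, whose walk grows by
          \<open>e\<close> at its end.\<close>
        then have "T e * (path u es * copath t fs) = T e * copath t fs"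
          using Nil V_copath[OF m(2)] by simp
        also have "\<dots> = T e * (V u * copath t fs)"
          using V_copath[OF m(2)] \<open>u = w\<close> by simp
        also have "\<dots> = V (head E e) * copath t (fs @ [e])"
          using T m \<open>u = w\<close> u copath_append[OF m(2), of "[e]"] copath_single[of e] T_V[of e]
          by (simp add: V_T T_V flip: mult.assoc)
        finally show ?thesis
          using path_copath_in_span[of "head E e" "[]" "head E e" t "fs @ [e]"] T m \<open>u = w\<close> u
          by (simp add: awalk_Nil_iff awalk_Cons_iff awalk_append_ex)
      next
        case (Cons f es')
        then have f: "f \<in> arcs E" "u = tail E f" "awalk (head E f) es' w"
          using m by (simp_all add: awalk_Cons_iff)
        have eq: "T e * (path u es * copath t fs) = (T e * S f) * path (head E f) es' * copath t fs"
          using f Cons by (simp add: path_Cons mult.assoc)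
        show ?thesis
        proof (cases "e = f")
          case True
          then show ?thesis unfolding eq
            using f m by (simp add: T_S V_path path_copath_in_span)
        next
          case False
          then show ?thesis unfolding eq
            using f T by (simp add: T_S_orth monomial_span.zero)
        qed
      qed
    next
      case False
      then have "T e * path u es = 0"
        using T m V_path_neq[of u "tail E e" es]
        by (metis T_V awalk_hd_in_verts tail_in_verts mult.assoc mult_zero_right)
      then show ?thesis by (simp add: monomial_span.zero flip: mult.assoc)
    qed
  qed
qed (auto simp: distrib_right mult.assoc intro: monomial_span_scale monomial_span.intros)

lemma alg_subset_span: "alg \<subseteq> monomial_span"
proof
  fix x assume "x \<in> alg"
  then show "x \<in> monomial_span"
  proof induction
    case (V v)
    then show ?case using path_copath_in_span[of v "[]" v v "[]"] by (simp add: awalk_Nil_iff V_idem)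
  next
    case (S e)
    then show ?case using path_copath_in_span[of "tail E e" "[e]" "head E e" "head E e" "[]"]
      by (simp add: awalk_Nil_iff awalk_Cons_iff path_single S_V)
  next
    case (T e)
    then show ?case using path_copath_in_span[of "head E e" "[]" "head E e" "tail E e" "[e]"]
      by (simp add: awalk_Nil_iff awalk_Cons_iff copath_single V_T)
  qed (auto intro: monomial_span.intros monomial_span_lmult monomial_span_scale)
qed

section \<open>Combinations of real paths and the removal of ghost edges\<close>

definition real_span :: "'v \<Rightarrow> 'v \<Rightarrow> 'r set" where
  "real_span u v = {\<Sum>es\<in>A. C (k es) * path u es | A k. finite A \<and> (\<forall>es\<in>A. awalk u es v)}"

lemma real_spanE:
  assumes "x \<in> real_span u v"
  obtains A k where "finite A" "\<And>es. es \<in> A \<Longrightarrow> awalk u es v" "x = (\<Sum>es\<in>A. C (k es) * path u es)"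
  using assms unfolding real_span_def by blast

lemma real_spanI:
  "\<lbrakk>finite A; \<And>es. es \<in> A \<Longrightarrow> awalk u es v\<rbrakk> \<Longrightarrow> (\<Sum>es\<in>A. C (k es) * path u es) \<in> real_span u v"
  unfolding real_span_def by blast

lemma real_span_zero: "0 \<in> real_span u v"
  using real_spanI[of "{}"] by simp

lemma real_span_path: "awalk u es v \<Longrightarrow> C k * path u es \<in> real_span u v"
  using real_spanI[of "{es}" u v "\<lambda>_. k"] by simp

lemma real_span_add:
  assumes "x \<in> real_span u v" "y \<in> real_span u v"
  shows "x + y \<in> real_span u v"
proof -
  obtain A k where A: "finite A" "\<And>es. es \<in> A \<Longrightarrow> awalk u es v" "x = (\<Sum>es\<in>A. C (k es) * path u es)"
    using assms(1) by (rule real_spanE) blast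
  obtain B l where B: "finite B" "\<And>es. es \<in> B \<Longrightarrow> awalk u es v" "y = (\<Sum>es\<in>B. C (l es) * path u es)"
    using assms(2) by (rule real_spanE) blast
  define k' where "k' es = (if es \<in> A then k es else 0)" for es
  define l' where "l' es = (if es \<in> B then l es else 0)" for es
  have "x = (\<Sum>es\<in>A \<union> B. C (k' es) * path u es)"
    unfolding A(3) k'_def by (rule sum.mono_neutral_cong_left) (auto simp: A B)
  moreover have "y = (\<Sum>es\<in>A \<union> B. C (l' es) * path u es)"
    unfolding B(3) l'_def by (rule sum.mono_neutral_cong_left) (auto simp: A B)
  ultimately have "x + y = (\<Sum>es\<in>A \<union> B. C (k' es + l' es) * path u es)"
    by (simp add: C_add distrib_right sum.distrib)
  then show ?thesis
    using real_spanI[of "A \<union> B" u v "\<lambda>es. k' es + l' es"] A(1,2) B(1,2) by auto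
qed

lemma real_span_V:
  assumes "x \<in> real_span u v"
  shows "x * V v = x"
proof -
  obtain A k where A: "finite A" "\<And>es. es \<in> A \<Longrightarrow> awalk u es v" "x = (\<Sum>es\<in>A. C (k es) * path u es)"
    using assms by (rule real_spanE) blast
  show ?thesis unfolding A(3) sum_distrib_right
    by (intro sum.cong refl) (simp add: mult.assoc path_V A(2))
qed

text \<open>Elements of \<open>real_span\<close> are sums over sets of distinct walks, the form to
  which independence applies. Appending \<open>e\<close> keeps distinct walks distinct and does not
  touch the coefficients, so multiplication by an edge is injective here.\<close>

lemma real_span_times_edge:
  assumes "x \<in> real_span u v" "e \<in> arcs E" "tail E e = v"
  shows "x * S e \<in> real_span u (head E e)" "x * S e = 0 \<Longrightarrow> x = 0"
proof -
  obtain A k where A: "finite A" "\<And>es. es \<in> A \<Longrightarrow> awalk u es v" "x = (\<Sum>es\<in>A. C (k es) * path u es)"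
    using assms(1) by (rule real_spanE) blast
  let ?A = "(\<lambda>es. es @ [e]) ` A"
  have fin: "finite ?A" using A by simp
  have walk: "awalk u es (head E e)" if es: "es \<in> ?A" for es
    using es A(2) assms(2,3) by (auto simp: awalk_append_ex awalk_Cons_iff awalk_Nil_iff)
  have "x * S e = (\<Sum>es\<in>A. C (k es) * path u (es @ [e]))"
    unfolding A(3) sum_distrib_right
    by (intro sum.cong refl)
      (use assms(2,3) path_single[of e] in \<open>simp add: path_append[OF A(2)] mult.assoc\<close>)
  then have eq: "x * S e = (\<Sum>es\<in>?A. C (k (butlast es)) * path u es)"
    by (simp add: sum.reindex inj_on_def)
  show "x * S e \<in> real_span u (head E e)"
    unfolding eq by (rule real_spanI[OF fin walk])
  assume "x * S e = 0"
  then have "k (butlast es) = 0" if "es \<in> ?A" for es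
    using path_independent[OF fin walk, where k = "\<lambda>es. k (butlast es)"] eq that by simp
  then have "k es = 0" if "es \<in> A" for es using that by force
  then show "x = 0" using A(3) by simp
qed

text \<open>The number bounds the length of the ghost paths at the right end and drives the
  induction in \<open>real_reduction\<close>; \<open>v\<close> is the vertex at which such an
  element ends, in the sense that \<open>x * V v = x\<close>.\<close>

inductive ghost_bounded :: "'v \<Rightarrow> nat \<Rightarrow> 'v \<Rightarrow> 'r \<Rightarrow> bool" for u where
  real: "x \<in> real_span u v \<Longrightarrow> ghost_bounded u n v x"
| ghost: "\<lbrakk>ghost_bounded u n (head E e) x; e \<in> arcs E\<rbrakk> \<Longrightarrow> ghost_bounded u (Suc n) (tail E e) (x * T e)"
| add: "\<lbrakk>ghost_bounded u n v x; ghost_bounded u n v y\<rbrakk> \<Longrightarrow> ghost_bounded u n v (x + y)"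

lemma ghost_bounded_zero: "ghost_bounded u n v 0"
  by (simp add: ghost_bounded.real real_span_zero)

lemma ghost_bounded_V: "ghost_bounded u n v x \<Longrightarrow> x * V v = x"
  by (induction rule: ghost_bounded.induct) (simp_all add: real_span_V T_V mult.assoc distrib_right)

lemma ghost_bounded_mono: "ghost_bounded u m v x \<Longrightarrow> m \<le> n \<Longrightarrow> ghost_bounded u n v x"
proof (induction arbitrary: n rule: ghost_bounded.induct)
  case (ghost m e x)
  then obtain n' where "n = Suc n'" "m \<le> n'" by (cases n) auto
  with ghost show ?case by (auto intro: ghost_bounded.ghost)
qed (auto intro: ghost_bounded.intros)

lemma ghost_bounded_monomial:
  "\<lbrakk>awalk u es w; awalk v fs w\<rbrakk> \<Longrightarrow> ghost_bounded u (length fs) v (C k * (path u es * copath v fs))"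
proof (induction fs arbitrary: v)
  case Nil
  then have "path u es * copath v [] = path u es"
    by (auto simp: awalk_Nil_iff path_V)
  then show ?case using Nil by (auto simp: awalk_Nil_iff real_span_path intro: ghost_bounded.real)
next
  case (Cons f fs)
  then have f: "f \<in> arcs E" "v = tail E f" "awalk (head E f) fs w"
    by (simp_all add: awalk_Cons_iff)
  then show ?case
    using ghost_bounded.ghost[OF Cons.IH[OF Cons.prems(1) f(3)] f(1)]
    by (simp add: copath_Cons mult.assoc)
qed

lemma corner_ghost_bounded:
  assumes "x \<in> monomial_span" "u \<in> verts E" "v \<in> verts E"
  shows "\<exists>n. ghost_bounded u n v (V u * x * V v)"
  using assms(1)
proof induction
  case zero
  show ?case using ghost_bounded_zero by auto
next
  case (monomial u' es w v' fs k)
  have eq: "V u * (C k * (path u' es * copath v' fs)) * V v = C k * ((V u * path u' es) * (copath v' fs * V v))"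
    by (simp add: mult.assoc C_left_commute)
  show ?case
  proof (cases "u' = u \<and> v' = v")
    case True
    then show ?thesis unfolding eq using ghost_bounded_monomial[of u es w v fs k] monomial assms
      by (auto simp: V_path copath_V)
  next
    case False
    then have "V u * path u' es = 0 \<or> copath v' fs * V v = 0"
      using monomial assms V_path_neq copath_V_neq by (metis awalk_hd_in_verts)
    then show ?thesis unfolding eq using ghost_bounded_zero by auto
  qed
next
  case (add x y)
  then obtain m n where "ghost_bounded u m v (V u * x * V v)" "ghost_bounded u n v (V u * y * V v)"
    by blast
  then have "ghost_bounded u (max m n) v (V u * x * V v + V u * y * V v)"
    by (intro ghost_bounded.add) (auto elim: ghost_bounded_mono)
  then show ?case by (auto simp: distrib_left distrib_right)
qed

text \<open>Collects the monomials by their last ghost edge. \<open>X\<close> is total and vanishes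
  outside \<open>F\<close>, so two such decompositions can be added over the union of their index
  sets.\<close>

lemma ghost_bounded_Suc:
  assumes "ghost_bounded u (Suc m) v x"
  shows "\<exists>y F X. y \<in> real_span u v \<and> finite F \<and> F \<subseteq> out_arcs E v \<and>
    (\<forall>e. ghost_bounded u m (head E e) (X e)) \<and> (\<forall>e. e \<notin> F \<longrightarrow> X e = 0) \<and>
    x = y + (\<Sum>e\<in>F. X e * T e)"
  using assms
proof (induction "Suc m" v x rule: ghost_bounded.induct)
  case (real x v)
  then show ?case
    by (intro exI[of _ x] exI[of _ "{}"] exI[of _ "\<lambda>_. 0"]) (simp add: ghost_bounded_zero)
next
  case (ghost e x)
  show ?case
    by (rule exI[of _ 0], rule exI[of _ "{e}"], rule exI[of _ "\<lambda>f. if f = e then x else 0"])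
      (use ghost in \<open>auto simp: ghost_bounded_zero real_span_zero\<close>)
next
  case (add v x y)
  then obtain y1 F1 X1 y2 F2 X2 where
    1: "y1 \<in> real_span u v" "finite F1" "F1 \<subseteq> out_arcs E v" "\<And>e. ghost_bounded u m (head E e) (X1 e)"
      "\<And>e. e \<notin> F1 \<Longrightarrow> X1 e = 0" "x = y1 + (\<Sum>e\<in>F1. X1 e * T e)" and
    2: "y2 \<in> real_span u v" "finite F2" "F2 \<subseteq> out_arcs E v" "\<And>e. ghost_bounded u m (head E e) (X2 e)"
      "\<And>e. e \<notin> F2 \<Longrightarrow> X2 e = 0" "y = y2 + (\<Sum>e\<in>F2. X2 e * T e)"
    by (elim exE conjE) blast
  have "(\<Sum>e\<in>F1. X1 e * T e) = (\<Sum>e\<in>F1 \<union> F2. X1 e * T e)"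
    by (rule sum.mono_neutral_left) (auto simp: 1 2)
  moreover have "(\<Sum>e\<in>F2. X2 e * T e) = (\<Sum>e\<in>F1 \<union> F2. X2 e * T e)"
    by (rule sum.mono_neutral_left) (auto simp: 1 2)
  ultimately have "x + y = (y1 + y2) + (\<Sum>e\<in>F1 \<union> F2. (X1 e + X2 e) * T e)"
    by (simp add: 1(6) 2(6) sum.distrib distrib_right algebra_simps)
  then show ?case
    by (intro exI[of _ "y1 + y2"] exI[of _ "F1 \<union> F2"] exI[of _ "\<lambda>e. X1 e + X2 e"])
      (use 1 2 in \<open>auto intro: ghost_bounded.add real_span_add\<close>)
qed

text \<open>Multiplying by an edge out of \<open>v\<close> lowers the ghost bound, so only an
  \<open>x\<close> killed by all these edges is a problem. For such an \<open>x\<close> the ghost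
  coefficients are forced to be \<open>- (y * S e)\<close>, which gives x = y (v - sum of
  \<open>S e * T e\<close> over \<open>F\<close>). As \<open>x\<close> is nonzero, so is
  \<open>y\<close>, and then \<open>F\<close> must contain every edge out of \<open>v\<close>. If
  there were any, \<open>v\<close> would be regular and its relation would make \<open>x\<close>
  zero; hence there are none and \<open>x = y\<close> is real.\<close>

lemma real_reduction:
  assumes "ghost_bounded u n v x" "x \<noteq> 0" "v \<in> verts E"
  shows "\<exists>w es. awalk v es w \<and> x * path v es \<in> real_span u w \<and> x * path v es \<noteq> 0"
  using assms
proof (induction n arbitrary: v x)
  case 0
  have "x \<in> real_span u v"
    using 0(1) by (induction "0::nat" v x rule: ghost_bounded.induct) (auto intro: real_span_add)
  then show ?case using 0
    by (intro exI[of _ v] exI[of _ "[]"]) (auto simp: real_span_V awalk_Nil_iff)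
next
  case (Suc m)
  obtain y F X where y: "y \<in> real_span u v" and F: "finite F" "F \<subseteq> out_arcs E v"
    and X: "\<And>e. ghost_bounded u m (head E e) (X e)" "\<And>e. e \<notin> F \<Longrightarrow> X e = 0"
    and x: "x = y + (\<Sum>e\<in>F. X e * T e)"
    using ghost_bounded_Suc[OF Suc.prems(1)] by blast
  have xS: "x * S e = y * S e + X e" if e: "e \<in> out_arcs E v" for e
  proof -
    have "X f * T f * S e = (if f = e then X e else 0)" if f: "f \<in> F" for f
      using ghost_bounded_V[OF X(1)[of e]] e f F(2) by (auto simp: mult.assoc T_S T_S_orth)
    then have "(\<Sum>f\<in>F. X f * T f * S e) = (\<Sum>f\<in>F. if f = e then X e else 0)"
      by (intro sum.cong) auto
    then show ?thesis using X(2) F(1) by (auto simp: x distrib_right sum_distrib_right)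
  qed
  show ?case
  proof (cases "\<exists>e\<in>out_arcs E v. x * S e \<noteq> 0")
    case True
    then obtain e where e: "e \<in> arcs E" "tail E e = v" "x * S e \<noteq> 0" by auto
    have "ghost_bounded u m (head E e) (x * S e)"
      unfolding xS[of e, simplified, OF conjI, OF e(1,2)]
      using real_span_times_edge(1)[OF y e(1,2)] X(1) by (auto intro: ghost_bounded.intros)
    from Suc.IH[OF this e(3)] e(1) obtain w es where w: "awalk (head E e) es w"
      "x * S e * path (head E e) es \<in> real_span u w" "x * S e * path (head E e) es \<noteq> 0"
      by auto
    then show ?thesis using e
      by (intro exI[of _ w] exI[of _ "e # es"]) (auto simp: awalk_Cons_iff path_Cons mult.assoc)
  next
    case False
    then have Xy: "X e = - (y * S e)" if "e \<in> out_arcs E v" for e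
      using xS[OF that] that by (simp add: eq_neg_iff_add_eq_0 add.commute)
    \<comment> \<open>The ghost part is now expressed through the real part \<open>y\<close>
      alone.\<close>
    then have "(\<Sum>e\<in>F. X e * T e) = (\<Sum>e\<in>F. - (y * (S e * T e)))"
      by (intro sum.cong) (use F in \<open>auto simp: mult.assoc\<close>)
    then have x': "x = y - y * (\<Sum>e\<in>F. S e * T e)"
      by (simp add: x sum_negf sum_distrib_left)
    have "out_arcs E v \<subseteq> F"
    proof
      fix f assume f: "f \<in> out_arcs E v"
      show "f \<in> F"
      proof (rule ccontr)
        assume "f \<notin> F"
        then have "y * S f = 0" using X(2) Xy[OF f] by simp
        then have "y = 0" using real_span_times_edge(2)[OF y] f by auto
        then show False using x' Suc.prems by simp
      qed
    qed
    then have "F = out_arcs E v" using F by auto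
    moreover have "F = {}"
    proof (rule ccontr)
      assume "F \<noteq> {}"
      then have "regular_vertex E v"
        using \<open>F = out_arcs E v\<close> F Suc.prems by (simp add: regular_vertex_def)
      then have "x = 0" using x' V_regular real_span_V[OF y] \<open>F = out_arcs E v\<close> by simp
      then show False using Suc.prems by simp
    qed
    ultimately have "x = y" using x by simp
    then show ?thesis using y Suc.prems
      by (intro exI[of _ v] exI[of _ "[]"]) (auto simp: real_span_V awalk_Nil_iff)
  qed
qed

section \<open>Ideals and their elements supported on closed walks\<close>

definition alg_ideal :: "'r set \<Rightarrow> bool" where
  "alg_ideal J \<longleftrightarrow> J \<subseteq> alg \<and> (\<forall>x\<in>J. \<forall>y\<in>J. x + y \<in> J) \<and> (\<forall>a\<in>alg. \<forall>x\<in>J. a * x \<in> J \<and> x * a \<in> J)"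

lemma alg_idealD:
  assumes "alg_ideal J"
  shows "x \<in> J \<Longrightarrow> x \<in> alg" "x \<in> J \<Longrightarrow> y \<in> J \<Longrightarrow> x + y \<in> J"
    "a \<in> alg \<Longrightarrow> x \<in> J \<Longrightarrow> a * x \<in> J" "a \<in> alg \<Longrightarrow> x \<in> J \<Longrightarrow> x * a \<in> J"
  using assms unfolding alg_ideal_def by auto

text \<open>The inverse scalar has to be carried by an element of \<open>alg\<close>, and
  \<open>C (inverse k) * V u\<close> is one.\<close>

lemma vertex_from_multiple:
  assumes "alg_ideal J" "u \<in> verts E" "k \<noteq> 0" "C k * V u \<in> J"
  shows "V u \<in> J"
proof -
  have "C (inverse k) * V u * (C k * V u) \<in> J"
    by (rule alg_idealD(3)[OF assms(1) alg.scale[OF alg.V[OF assms(2)]] assms(4)])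
  moreover have "C (inverse k) * V u * (C k * V u) = C (inverse k * k) * (V u * V u)"
    by (metis C_mult C_left_commute mult.assoc)
  ultimately show ?thesis using assms by (simp add: C_one V_idem)
qed

text \<open>The closed walks are values \<open>g i\<close> at indices in \<open>G\<close>, not
  members of a set: conjugation by a path changes the walks but keeps the indices and the
  coefficients.\<close>

definition closed_form :: "'r set \<Rightarrow> 'v \<Rightarrow> 'e list set \<Rightarrow> 'k \<Rightarrow> ('e list \<Rightarrow> 'k) \<Rightarrow> ('e list \<Rightarrow> 'e list) \<Rightarrow> bool" where
  "closed_form J v G k h g \<longleftrightarrow> v \<in> verts E \<and> k \<noteq> 0 \<and> finite G \<and>
    (\<forall>i\<in>G. awalk v (g i) v \<and> g i \<noteq> []) \<and> C k * V v + (\<Sum>i\<in>G. C (h i) * path v (g i)) \<in> J"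

lemma real_span_closed_form:
  assumes J: "alg_ideal J" and x: "x \<in> J" "x \<in> real_span u v" "x \<noteq> 0"
  shows "\<exists>G k h g. closed_form J v G k h g"
proof -
  obtain A k where A: "finite A" "\<And>es. es \<in> A \<Longrightarrow> awalk u es v" "x = (\<Sum>es\<in>A. C (k es) * path u es)"
    using x(2) by (rule real_spanE) blast
  \<comment> \<open>Zero coefficients are dropped before a shortest walk is chosen, because its
    coefficient becomes the scalar in front of the vertex.\<close>
  define B where "B = {es \<in> A. k es \<noteq> 0}"
  have B: "finite B" "\<And>es. es \<in> B \<Longrightarrow> awalk u es v" "x = (\<Sum>es\<in>B. C (k es) * path u es)"
    using A unfolding B_def by (auto intro: sum.mono_neutral_right)
  have "B \<noteq> {}" using x(3) B(3) by auto
  then obtain p where p: "p \<in> B" "\<And>q. q \<in> B \<Longrightarrow> length p \<le> length q"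
    using ex_has_least_nat[of "\<lambda>p. p \<in> B" _ length] by blast
  have walk: "awalk u p v" using B(2) p(1) by blast
  define G where "G = {q \<in> B. prefix p q \<and> q \<noteq> p}"
  define g where "g q = drop (length p) q" for q :: "'e list"
  have g: "awalk v (g q) v" "g q \<noteq> []" "copath u p * path u q = path v (g q)" if "q \<in> G" for q
  proof -
    have "prefix p q" "q \<noteq> p" using that by (auto simp: G_def)
    then obtain r where r: "q = p @ r" "r \<noteq> []" by (auto simp: prefix_def)
    moreover have "awalk u (p @ r) v" using B(2)[of q] that r by (simp add: G_def)
    then obtain w where "awalk u p w" "awalk w r v" unfolding awalk_append_ex by blast
    moreover from this have "w = v" using walk awalk_ends_eqD by blast
    ultimately show "awalk v (g q) v" "g q \<noteq> []" "copath u p * path u q = path v (g q)"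
      by (simp_all add: g_def copath_path_append)
  qed
  \<comment> \<open>As \<open>p\<close> is shortest, a walk that does not begin with
    \<open>p\<close> is incomparable with it.\<close>
  have other: "copath u p * path u q = 0" if "q \<in> B" "q \<notin> G" "q \<noteq> p" for q
  proof (rule copath_path_incomparable[OF walk B(2)[OF that(1)]])
    show "\<not> prefix p q" using that by (auto simp: G_def)
    show "\<not> prefix q p" using that p(2)[OF that(1)] by (auto simp: prefix_def)
  qed
  have "copath u p * x = (\<Sum>q\<in>B. C (k q) * (copath u p * path u q))"
    unfolding B(3) by (simp add: sum_distrib_left C_left_commute)
  also have "\<dots> = (\<Sum>q\<in>insert p G. C (k q) * (copath u p * path u q))"
  proof (rule sum.mono_neutral_right[OF B(1)])
    show "insert p G \<subseteq> B" using p(1) by (auto simp: G_def)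
  qed (use other in simp)
  also have "\<dots> = C (k p) * V v + (\<Sum>q\<in>G. C (k q) * (copath u p * path u q))"
    using B(1) by (subst sum.insert) (auto simp: G_def copath_path[OF walk])
  also have "\<dots> = C (k p) * V v + (\<Sum>q\<in>G. C (k q) * path v (g q))"
    by (simp add: g(3))
  finally have "C (k p) * V v + (\<Sum>q\<in>G. C (k q) * path v (g q)) \<in> J"
    using alg_idealD(3)[OF J copath_in_alg[OF walk] x(1)] by simp
  moreover have "finite G" "k p \<noteq> 0"
    using B(1) p(1) by (simp_all add: G_def) (simp add: B_def)
  ultimately have "closed_form J v G (k p) k g"
    unfolding closed_form_def using g(1,2) awalk_last_in_verts[OF walk] by blast
  then show ?thesis by blast
qed

text \<open>That \<open>es\<close> is a prefix of \<open>g i @ es\<close> expresses that it is an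
  initial piece of the infinite repetition of \<open>g i\<close>. A walk for which this fails kills
  the term of \<open>g i\<close> under conjugation, so the number of terms decreases.\<close>

lemma exitless_closed_form:
  assumes J: "alg_ideal J" "\<And>w. w \<in> verts E \<Longrightarrow> V w \<notin> J"
    and "closed_form J v G k h g"
  shows "\<exists>v G k h g. closed_form J v G k h g \<and> G \<noteq> {} \<and>
    (\<forall>i\<in>G. \<forall>es w. awalk v es w \<longrightarrow> prefix es (g i @ es))"
  using assms(3)
proof (induction "card G" arbitrary: v G h g rule: less_induct)
  case less
  then have v: "v \<in> verts E" "k \<noteq> 0" "finite G" "\<And>i. i \<in> G \<Longrightarrow> awalk v (g i) v" "\<And>i. i \<in> G \<Longrightarrow> g i \<noteq> []"
    "C k * V v + (\<Sum>i\<in>G. C (h i) * path v (g i)) \<in> J" (is "?z \<in> J")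
    by (auto simp: closed_form_def)
  have "G \<noteq> {}"
  proof
    assume "G = {}"
    then have "C k * V v \<in> J" using v by simp
    then have "V v \<in> J" by (rule vertex_from_multiple[OF J(1) v(1,2)])
    then show False using J(2) v by blast
  qed
  show ?case
  proof (cases "\<forall>i\<in>G. \<forall>es w. awalk v es w \<longrightarrow> prefix es (g i @ es)")
    case True
    then show ?thesis using less.prems \<open>G \<noteq> {}\<close> by blast
  next
    case False
    then obtain j p w where j: "j \<in> G" "awalk v p w" "\<not> prefix p (g j @ p)" by blast
    define H where "H = {i \<in> G. prefix p (g i @ p)}"
    \<comment> \<open>Conjugation by \<open>p\<close> turns \<open>g i\<close> into the walk
      \<open>r\<close> with \<open>g i @ p = p @ r\<close>. It is closed at \<open>w\<close> and has
      the length of \<open>g i\<close>, hence is nonempty.\<close>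
    define g' where "g' i = drop (length p) (g i @ p)" for i
    have cancel: "copath v p * path v (g i @ p) = path w (g' i)" "awalk w (g' i) w" "g' i \<noteq> []"
      if i: "i \<in> H" for i
    proof -
      obtain r where r: "g i @ p = p @ r" using i by (auto simp: H_def prefix_def)
      then have "awalk v (p @ r) w"
        using v(4)[of i] that j(2) by (auto simp: H_def awalk_append_ex simp flip: r)
      then have "awalk w r w" using j(2) awalk_ends_eqD by (auto simp: awalk_append_ex)
      moreover have "length r = length (g i)" using arg_cong[OF r, of length] by simp
      ultimately show "copath v p * path v (g i @ p) = path w (g' i)" "awalk w (g' i) w" "g' i \<noteq> []"
        using r v(5)[of i] that copath_path_append[OF j(2)] by (auto simp: g'_def H_def)
    qed
    have vanish: "copath v p * path v (g i @ p) = 0" if "i \<in> G" "i \<notin> H" for i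
    proof (rule copath_path_incomparable[OF j(2)])
      show "awalk v (g i @ p) w" using v(4)[OF that(1)] j(2) by (auto simp: awalk_append_ex)
      show "\<not> prefix p (g i @ p)" using that by (simp add: H_def)
      show "\<not> prefix (g i @ p) p"
        using v(5)[OF that(1)] prefix_length_le[of "g i @ p" p] by auto
    qed
    have "copath v p * ?z * path v p = C k * (copath v p * (V v * path v p))
        + (\<Sum>i\<in>G. C (h i) * (copath v p * (path v (g i) * path v p)))"
      by (simp add: distrib_left distrib_right sum_distrib_left sum_distrib_right C_left_commute mult.assoc)
    also have "\<dots> = C k * V w + (\<Sum>i\<in>G. C (h i) * (copath v p * path v (g i @ p)))"
      using v(1) copath_path[OF j(2)] by (simp add: V_path path_append[OF v(4)] cong: sum.cong)
    also have "\<dots> = C k * V w + (\<Sum>i\<in>H. C (h i) * path w (g' i))"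
    proof (rule arg_cong[of _ _ "(+) _"], rule sum.mono_neutral_cong_right[OF v(3)])
      show "H \<subseteq> G" by (auto simp: H_def)
    qed (simp_all add: vanish cancel(1))
    finally have eq: "copath v p * ?z * path v p = C k * V w + (\<Sum>i\<in>H. C (h i) * path w (g' i))" .
    have "copath v p * ?z * path v p \<in> J"
      by (intro alg_idealD(3,4)[OF J(1)] path_in_alg[OF j(2)] copath_in_alg[OF j(2)] v(6))
    then have "C k * V w + (\<Sum>i\<in>H. C (h i) * path w (g' i)) \<in> J" unfolding eq .
    then have "closed_form J w H k h g'"
      unfolding closed_form_def using v j(2) cancel by (auto simp: H_def awalk_last_in_verts)
    moreover have "card H < card G"
      by (rule psubset_card_mono) (use v j in \<open>auto simp: H_def\<close>)
    ultimately show ?thesis using less.hyps by blast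
  qed
qed

section \<open>Powers of ideals and local units\<close>

inductive_set products :: "'r set \<Rightarrow> 'r set \<Rightarrow> 'r set" for A B where
  mult: "\<lbrakk>a \<in> A; b \<in> B\<rbrakk> \<Longrightarrow> a * b \<in> products A B"
| add: "\<lbrakk>x \<in> products A B; y \<in> products A B\<rbrakk> \<Longrightarrow> x + y \<in> products A B"

lemma alg_ideal_products:
  assumes A: "alg_ideal A" and B: "alg_ideal B"
  shows "alg_ideal (products A B)"
  unfolding alg_ideal_def
proof (intro conjI subsetI ballI)
  fix x assume "x \<in> products A B"
  then show "x \<in> alg" by induction (auto intro: alg.intros alg_idealD[OF A] alg_idealD[OF B])
next
  fix a x assume a: "a \<in> alg" and "x \<in> products A B"
  from this(2) show "a * x \<in> products A B"
  proof induction
    case (mult x y)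
    from products.mult[OF alg_idealD(3)[OF A a mult(1)] mult(2)] show ?case by (simp add: mult.assoc)
  qed (simp add: distrib_left products.add)
next
  fix a x assume a: "a \<in> alg" and "x \<in> products A B"
  from this(2) show "x * a \<in> products A B"
  proof induction
    case (mult x y)
    from products.mult[OF mult(1) alg_idealD(4)[OF B a mult(2)]] show ?case by (simp add: mult.assoc)
  qed (simp add: distrib_right products.add)
qed (rule products.add)

text \<open>\<open>powers J n\<close> is the power of exponent \<open>n + 1\<close>.\<close>

primrec powers :: "'r set \<Rightarrow> nat \<Rightarrow> 'r set" where
  "powers J 0 = J"
| "powers J (Suc n) = products (powers J n) J"

lemma alg_ideal_powers: "alg_ideal J \<Longrightarrow> alg_ideal (powers J n)"
  by (induction n) (simp_all add: alg_ideal_products)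

text \<open>The claim covers every larger finite set of vertices, so that the union serves both
  summands of a sum at once.\<close>

lemma local_units:
  assumes "x \<in> monomial_span"
  shows "\<exists>U. finite U \<and> U \<subseteq> verts E \<and>
    (\<forall>U'. finite U' \<longrightarrow> U \<subseteq> U' \<longrightarrow> U' \<subseteq> verts E \<longrightarrow> sum V U' * x = x \<and> x * sum V U' = x)"
  using assms
proof induction
  case zero
  show ?case by (intro exI[of _ "{}"]) simp
next
  case (monomial u es w v fs k)
  have uv: "u \<in> verts E" "v \<in> verts E" using monomial awalk_hd_in_verts by auto
  show ?case
  proof (intro exI[of _ "{u, v}"] conjI allI impI)
    fix U assume U: "finite U" "{u, v} \<subseteq> U" "U \<subseteq> verts E"
    have "sum V U * path u es = (\<Sum>t\<in>U. if t = u then path u es else 0)"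
      unfolding sum_distrib_right using uv U by (intro sum.cong) (auto simp: V_path V_path_neq)
    then have 1: "sum V U * path u es = path u es" using U by simp
    have "copath v fs * sum V U = (\<Sum>t\<in>U. if t = v then copath v fs else 0)"
      unfolding sum_distrib_left using uv U by (intro sum.cong) (auto simp: copath_V copath_V_neq)
    then have 2: "copath v fs * sum V U = copath v fs" using U by simp
    show "sum V U * (C k * (path u es * copath v fs)) = C k * (path u es * copath v fs)"
      using 1 by (metis C_left_commute mult.assoc)
    show "C k * (path u es * copath v fs) * sum V U = C k * (path u es * copath v fs)"
      using 2 by (simp add: mult.assoc)
  qed (use uv in auto)
next
  case (add x y)
  then obtain A B where
    A: "finite A" "A \<subseteq> verts E" "\<And>U. finite U \<Longrightarrow> A \<subseteq> U \<Longrightarrow> U \<subseteq> verts E \<Longrightarrow> sum V U * x = x \<and> x * sum V U = x" and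
    B: "finite B" "B \<subseteq> verts E" "\<And>U. finite U \<Longrightarrow> B \<subseteq> U \<Longrightarrow> U \<subseteq> verts E \<Longrightarrow> sum V U * y = y \<and> y * sum V U = y"
    by blast
  show ?case
  proof (intro exI[of _ "A \<union> B"] conjI allI impI)
    fix U assume "finite U" "A \<union> B \<subseteq> U" "U \<subseteq> verts E"
    then show "sum V U * (x + y) = x + y" "(x + y) * sum V U = x + y"
      using A(3)[of U] B(3)[of U] by (simp_all add: distrib_left distrib_right)
  qed (use A B in auto)
qed

lemma nonzero_corner:
  assumes "x \<in> monomial_span" "x \<noteq> 0"
  obtains u w where "u \<in> verts E" "w \<in> verts E" "V u * x * V w \<noteq> 0"
proof -
  obtain U where U: "U \<subseteq> verts E" "sum V U * x = x" "x * sum V U = x"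
    using local_units[OF assms(1)] by auto
  have "x = sum V U * x * sum V U" using U by simp
  also have "\<dots> = (\<Sum>w\<in>U. \<Sum>u\<in>U. V u * x * V w)"
    by (simp add: sum_distrib_left sum_distrib_right)
  finally have "\<exists>w\<in>U. \<exists>u\<in>U. V u * x * V w \<noteq> 0" using assms(2) by (metis (no_types, lifting) sum.neutral)
  then show ?thesis using U that by blast
qed

end

section \<open>Cycles without exits\<close>

text \<open>Since \<open>f\<close> does not vanish at 0, a root 0 of the product must come from the
  cofactor of \<open>f ^ k\<close>; so factors of the variable cancel one at a time.\<close>

lemma power_dvd_cancel_monom:
  fixes f p :: "'a::field poly"
  assumes "coeff f 0 \<noteq> 0" "f ^ k dvd p * monom 1 n"
  shows "f ^ k dvd p"
  using assms(2)
proof (induction n)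
  case 0
  then show ?case by (simp add: one_poly_def monom_0)
next
  case (Suc n)
  have "p * monom 1 (Suc n) = [:0, 1:] * (p * monom 1 n)" by (simp add: monom_Suc)
  then obtain g where g: "[:0, 1:] * (p * monom 1 n) = f ^ k * g" using Suc.prems by (metis dvdE)
  then have "poly (f ^ k * g) 0 = 0" by (metis mult_zero_left poly_mult poly_pCons add_0 poly_0)
  then have "poly g 0 = 0" using assms(1) by (simp add: poly_0_coeff_0 coeff_mult_0 coeff_0_power)
  then obtain g' where "g = [:0, 1:] * g'" by (auto simp: poly_eq_0_iff_dvd)
  then have "[:0, 1:] * (p * monom 1 n) = [:0, 1:] * (f ^ k * g')" using g by (simp only: mult.left_commute)
  then have "p * monom 1 n = f ^ k * g'" by (subst (asm) mult_cancel_left) simp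
  then show ?case using Suc.IH by simp
qed

text \<open>Iterating the hypothesis makes \<open>p\<close> a prefix of \<open>n\<close> copies of
  \<open>c\<close> followed by \<open>p\<close>; once these copies are at least as long as
  \<open>p\<close>, it fits inside them.\<close>

lemma prefix_replicate:
  assumes "prefix p (c @ p)" "c \<noteq> []" "length p \<le> n"
  shows "prefix p (concat (replicate n c))"
proof -
  have "prefix p (concat (replicate n c) @ p)"
  proof (induction n)
    case (Suc n)
    then have "prefix (c @ p) (c @ concat (replicate n c) @ p)" by simp
    with assms(1) show ?case by (auto intro: prefix_order.trans)
  qed simp
  moreover have "n \<le> n * length c" using assms(2) by (cases c) auto
  then have "length p \<le> length (concat (replicate n c))"
    using assms(3) by (intro order.trans[OF assms(3)]) (simp add: length_concat sum_list_replicate)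
  ultimately show ?thesis by (rule prefix_length_prefix[OF _ prefixI[OF refl]])
qed

text \<open>Comparability of all walks from \<open>v\<close> encodes the absence of exits without
  speaking of the vertices on the cycle. Minimal length makes every closed walk at \<open>v\<close>
  a power of \<open>c\<close>.\<close>

locale exitless_cycle = leavitt_family E C V S T
  for E :: "('v, 'e) pre_digraph" and C :: "'k::field \<Rightarrow> 'r::{ring,monoid_mult}" and V S T +
  fixes v :: 'v and c :: "'e list"
  assumes c_walk: "awalk v c v" and c_nonempty: "c \<noteq> []"
    and walks_comparable: "awalk v p x \<Longrightarrow> awalk v q y \<Longrightarrow> prefix p q \<or> prefix q p"
    and c_shortest: "awalk v d v \<Longrightarrow> d \<noteq> [] \<Longrightarrow> length c \<le> length d"

lemma (in leavitt_family) obtain_exitless_cycle: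
  assumes "awalk v g v" "g \<noteq> []" "\<And>es w. awalk v es w \<Longrightarrow> prefix es (g @ es)"
  shows "\<exists>c. exitless_cycle E C V S T v c"
proof -
  obtain c where c: "awalk v c v" "c \<noteq> []" "\<And>d. awalk v d v \<Longrightarrow> d \<noteq> [] \<Longrightarrow> length c \<le> length d"
    using ex_has_least_nat[of "\<lambda>c. awalk v c v \<and> c \<noteq> []" g length] assms by blast
  \<comment> \<open>Both walks are prefixes of the same repetition of \<open>g\<close>; the sum of
    their lengths is a number of copies large enough for either.\<close>
  have "prefix p q \<or> prefix q p" if "awalk v p x" "awalk v q y" for p q x y
    using prefix_replicate[OF assms(3)[OF that(1)] assms(2), of "length p + length q"]
      prefix_replicate[OF assms(3)[OF that(2)] assms(2), of "length p + length q"]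
      prefix_same_cases by auto
  with c show ?thesis
    by (intro exI[of _ c] exitless_cycle.intro leavitt_family_axioms) (unfold_locales, auto)
qed

context exitless_cycle
begin

lemma v_vert: "v \<in> verts E"
  using c_walk by (rule awalk_hd_in_verts)

section \<open>Powers of the cycle and the walks from its base vertex\<close>

definition cyc :: "nat \<Rightarrow> 'e list" where "cyc n = concat (replicate n c)"

lemma cyc_0 [simp]: "cyc 0 = []" and cyc_Suc: "cyc (Suc n) = c @ cyc n"
  by (simp_all add: cyc_def)

lemma cyc_add: "cyc (m + n) = cyc m @ cyc n"
  by (simp add: cyc_def replicate_add)

lemma cyc_walk: "awalk v (cyc n) v"
  by (induction n) (use v_vert c_walk in \<open>auto simp: cyc_Suc awalk_Nil_iff awalk_append_ex\<close>)

lemma length_cyc: "length (cyc n) = n * length c"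
  by (simp add: cyc_def length_concat sum_list_replicate)

lemma le_length_cyc: "n \<le> length (cyc n)"
  using mult_le_mono2[of 1 "length c" n] c_nonempty by (simp add: length_cyc Suc_leI)

lemma inj_cyc: "inj cyc"
  using c_nonempty by (intro injI) (metis length_cyc length_0_conv mult_right_cancel)

text \<open>The strict bound keeps \<open>q\<close> nonempty; its first edge is the one found in
  \<open>unique_out_arc\<close>.\<close>

lemma walk_extends_to_cyc:
  assumes "awalk v p w" "length p < n"
  obtains q where "cyc n = p @ q" "q \<noteq> []" "awalk w q v"
proof -
  have "prefix p (cyc n)"
    using walks_comparable[OF assms(1) cyc_walk[of n]] le_length_cyc[of n] assms(2)
    by (auto dest: prefix_length_le)
  then obtain q where q: "cyc n = p @ q" by (auto simp: prefix_def)
  moreover have "q \<noteq> []" using q le_length_cyc[of n] assms(2) by auto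
  moreover have "awalk w q v"
    using cyc_walk[of n] assms(1) awalk_ends_eqD by (auto simp: q awalk_append_ex)
  ultimately show ?thesis by (rule that)
qed

text \<open>Minimality of \<open>c\<close> decides that, of the comparable walks \<open>c\<close>
  and \<open>d\<close>, it is \<open>c\<close> that comes first. The rest of \<open>d\<close> is
  closed at \<open>v\<close> again, so copies of \<open>c\<close> peel off.\<close>

lemma closed_walk_is_cyc: "awalk v d v \<Longrightarrow> \<exists>m. d = cyc m"
proof (induction d rule: length_induct)
  case (1 d)
  show ?case
  proof (cases "d = []")
    case True
    then show ?thesis by (intro exI[of _ 0]) simp
  next
    case False
    then have "prefix c d"
      using walks_comparable[OF c_walk 1(2)] c_shortest[OF 1(2)] by (auto simp: prefix_def)
    then obtain d' where d': "d = c @ d'" by (auto simp: prefix_def)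
    then have "awalk v d' v" using 1(2) c_walk awalk_ends_eqD by (auto simp: awalk_append_ex)
    then obtain m where "d' = cyc m" using 1(1) d' c_nonempty by force
    then show ?thesis using d' by (intro exI[of _ "Suc m"]) (simp add: cyc_Suc)
  qed
qed

text \<open>Two edges would extend \<open>p\<close> to incomparable walks. One edge exists because
  \<open>p\<close> can be continued back to \<open>v\<close>.\<close>

lemma unique_out_arc:
  assumes "awalk v p w"
  shows "\<exists>e. out_arcs E w = {e}"
proof -
  obtain q where q: "q \<noteq> []" "awalk w q v" using walk_extends_to_cyc[OF assms lessI] .
  then obtain e where e: "e \<in> arcs E" "tail E e = w"
    by (cases q) (auto simp: awalk_Cons_iff)
  have unique: "f = e" if f: "f \<in> arcs E" "tail E f = w" for f
  proof -
    have "awalk v (p @ [e]) (head E e)" "awalk v (p @ [f]) (head E f)"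
      using assms e f by (auto simp: awalk_append_ex awalk_Cons_iff awalk_Nil_iff)
    from walks_comparable[OF this] show "f = e" by auto
  qed
  have "out_arcs E w = {e}"
  proof (intro equalityI subsetI)
    fix f assume "f \<in> out_arcs E w"
    then show "f \<in> {e}" using unique[of f] by simp
  qed (use e in simp)
  then show ?thesis by blast
qed

text \<open>Each vertex passed emits a single edge, so its regular relation reads
  \<open>V (tail E e) = S e * T e\<close> and the product collapses from the middle. In particular
  the cycle is invertible in the corner at \<open>v\<close>.\<close>

lemma path_copath: "awalk v p w \<Longrightarrow> path v p * copath v p = V v"
proof (induction p arbitrary: w rule: rev_induct)
  case Nil
  then show ?case using v_vert by (simp add: V_idem)
next
  case (snoc e p)
  then have e: "e \<in> arcs E" "awalk v p (tail E e)"
    by (auto simp: awalk_append_ex awalk_Cons_iff)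
  have "e \<in> out_arcs E (tail E e)" using e(1) by simp
  then have "out_arcs E (tail E e) = {e}" using unique_out_arc[OF e(2)] by (metis singletonD)
  then have "V (tail E e) = S e * T e"
    using V_regular[of "tail E e"] e by (simp add: regular_vertex_def)
  then have "path v (p @ [e]) * copath v (p @ [e]) = path v p * (V (tail E e) * copath v p)"
    using e path_single[of e] copath_single[of e]
    by (simp add: path_append[OF e(2)] copath_append[OF e(2)] mult.assoc)
  then show ?case using snoc.IH[OF e(2)] V_copath[OF e(2)] by simp
qed

section \<open>The corner at \<open>v\<close> and polynomials in the cycle\<close>

abbreviation W :: "nat \<Rightarrow> 'r" where "W n \<equiv> path v (cyc n)"
abbreviation W' :: "nat \<Rightarrow> 'r" where "W' n \<equiv> copath v (cyc n)"

lemma W_mult: "W m * W n = W (m + n)"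
  by (simp add: cyc_add path_append[OF cyc_walk])

lemma W_W': "W n * W' n = V v" and W'_W: "W' n * W n = V v"
  using path_copath[OF cyc_walk] copath_path[OF cyc_walk] by simp_all

lemma W_in_alg: "W n \<in> alg" and W'_in_alg: "W' n \<in> alg"
  by (rule path_in_alg copath_in_alg, rule cyc_walk)+

lemma V_W: "V v * W n = W n" and W_V: "W n * V v = W n"
  by (simp_all add: V_path v_vert path_V[OF cyc_walk])

text \<open>\<open>W' n\<close> is the inverse of \<open>W n\<close> in the corner at
  \<open>v\<close>, and an inverse commutes with whatever its element commutes with.\<close>

lemma W'_commute: "W' n * W m = W m * W' n"
proof -
  have comm: "W m * W n = W n * W m" by (simp add: W_mult add.commute)
  have "W' n * W m = W' n * (W m * W n) * W' n" by (simp add: W_W' W_V mult.assoc)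
  also have "\<dots> = (W' n * W n) * W m * W' n" unfolding comm by (simp only: mult.assoc)
  finally show ?thesis by (simp add: W'_W V_W)
qed

text \<open>Substitution of the cycle for the variable, with \<open>V v\<close> as its zeroth power;
  thus constants land in the corner at \<open>v\<close>.\<close>

definition ev :: "'k poly \<Rightarrow> 'r" where
  "ev p = (\<Sum>i\<le>degree p. C (coeff p i) * W i)"

lemma ev_bound: "degree p \<le> n \<Longrightarrow> ev p = (\<Sum>i\<le>n. C (coeff p i) * W i)"
  unfolding ev_def by (rule sum.mono_neutral_left) (auto simp: coeff_eq_0)

lemma ev_0 [simp]: "ev 0 = 0"
  by (simp add: ev_def)

lemma ev_add: "ev (p + q) = ev p + ev q"
proof -
  let ?n = "max (degree p) (degree q)"
  have "ev (p + q) = (\<Sum>i\<le>?n. C (coeff (p + q) i) * W i)"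
    by (rule ev_bound) (rule degree_add_le_max)
  then show ?thesis
    by (simp add: ev_bound[of p ?n] ev_bound[of q ?n] C_add distrib_right sum.distrib)
qed

lemma ev_smult: "ev (smult a p) = C a * ev p"
  by (simp add: ev_bound[OF degree_smult_le] ev_def C_mult mult.assoc sum_distrib_left)

lemma ev_pCons: "ev (pCons a p) = C a * V v + W 1 * ev p"
proof -
  have "ev (pCons a p) = (\<Sum>i\<le>Suc (degree p). C (coeff (pCons a p) i) * W i)"
    by (rule ev_bound) (rule degree_pCons_le)
  also have "\<dots> = C a * V v + (\<Sum>i\<le>degree p. C (coeff p i) * W (Suc i))"
    by (subst sum.atMost_Suc_shift) simp
  finally show ?thesis
    by (simp add: ev_def sum_distrib_left C_left_commute W_mult)
qed

lemma V_ev: "V v * ev p = ev p"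
  by (simp add: ev_def sum_distrib_left C_left_commute V_W)

lemma ev_V: "ev p * V v = ev p"
  by (simp add: ev_def sum_distrib_right mult.assoc W_V)

lemma ev_mult: "ev (p * q) = ev p * ev q"
proof (induction p)
  case (pCons a p)
  have "ev (pCons a p * q) = C a * ev q + W 1 * (ev p * ev q)"
    using pCons.IH by (simp add: mult_pCons_left ev_add ev_smult ev_pCons)
  then show ?case by (simp add: ev_pCons distrib_right mult.assoc V_ev)
qed simp

lemma ev_monom: "ev (monom k n) = C k * W n"
  by (induction n) (simp_all add: monom_0 monom_Suc ev_pCons C_left_commute W_mult)

lemma ev_sum: "ev (sum p A) = (\<Sum>i\<in>A. ev (p i))"
  by (induction A rule: infinite_finite_induct) (simp_all add: ev_add)

lemma ev_in_alg: "ev p \<in> alg"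
  unfolding ev_def by (intro alg_sum alg.scale W_in_alg)

lemma ev_W: "ev p * W n = ev (p * monom 1 n)"
  by (simp add: ev_mult ev_monom C_one)

lemma ev_W_commute: "ev p * W n = W n * ev p"
  by (simp add: ev_def sum_distrib_left sum_distrib_right C_left_commute W_mult mult.assoc add.commute)

lemma ev_W'_commute: "W' n * ev p = ev p * W' n"
  by (simp add: ev_def sum_distrib_left sum_distrib_right C_left_commute W'_commute mult.assoc)

text \<open>Different powers of the cycle are different walks, so independence forces the leading
  coefficient to vanish.\<close>

lemma ev_eq_0:
  assumes "ev p = 0" shows "p = 0"
proof -
  let ?A = "cyc ` {..degree p}"
  have eq: "(\<Sum>es\<in>?A. C (coeff p (inv_into UNIV cyc es)) * path v es) = ev p"
    unfolding ev_def using inj_cyc by (subst sum.reindex) (auto intro: inj_on_subset)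
  have walk: "awalk v es v" if "es \<in> ?A" for es using that cyc_walk by auto
  have "coeff p (inv_into UNIV cyc (cyc (degree p))) = 0"
    by (rule path_independent[OF _ walk eq[unfolded assms]]) simp_all
  then show ?thesis using inj_cyc by (simp add: leading_coeff_0_iff)
qed

lemma ev_inj: "ev p = ev q \<Longrightarrow> p = q"
  using ev_eq_0[of "p - q"] ev_add[of "p - q" q] by simp

text \<open>Walks into \<open>v\<close> that do not end with a full turn of the cycle: a basis of
  \<open>L\<^sub>K(E) v\<close> over the Laurent polynomials \<open>v L\<^sub>K(E) v\<close>.\<close>

definition reduced :: "('v \<times> 'e list) set" where
  "reduced = {(u, q). awalk u q v \<and> \<not> suffix c q}"

lemma reduced_Nil: "(v, []) \<in> reduced"
  using v_vert c_nonempty by (simp add: reduced_def awalk_Nil_iff)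

lemma cyc_Suc_right: "cyc (Suc n) = cyc n @ c"
  using cyc_add[of n 1] by (simp add: cyc_def)

lemma reduced_decomposition:
  "awalk u es v \<Longrightarrow> \<exists>q m. (u, q) \<in> reduced \<and> es = q @ cyc m"
proof (induction es rule: length_induct)
  case (1 es)
  show ?case
  proof (cases "suffix c es")
    case True
    then obtain es' where es: "es = es' @ c" by (auto simp: suffix_def)
    then obtain x where x: "awalk u es' x" "awalk x c v" using 1(2) by (auto simp: awalk_append_ex)
    then have "x = v" using c_walk c_nonempty by (cases c) (auto simp: awalk_Cons_iff)
    then have "awalk u es' v" "length es' < length es" using x es c_nonempty by simp_all
    then obtain q m where "(u, q) \<in> reduced" "es' = q @ cyc m" using 1(1) by blast
    then show ?thesis using es by (intro exI[of _ q] exI[of _ "Suc m"]) (simp add: cyc_Suc_right)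
  next
    case False
    then show ?thesis using 1(2) by (intro exI[of _ es] exI[of _ 0]) (simp add: reduced_def)
  qed
qed

text \<open>What \<open>q'\<close> has beyond \<open>q\<close> is a closed walk at \<open>v\<close>,
  hence a power of \<open>c\<close>; a positive power would make \<open>q'\<close> end with
  \<open>c\<close>.\<close>

lemma reduced_prefix:
  assumes "(u, q) \<in> reduced" "(u, q') \<in> reduced" "prefix q q'"
  shows "q = q'"
proof -
  obtain d where d: "q' = q @ d" using assms(3) by (auto simp: prefix_def)
  have "awalk u q v" "awalk u (q @ d) v" using assms d by (auto simp: reduced_def)
  then have "awalk v d v" using awalk_ends_eqD by (auto simp: awalk_append_ex)
  then obtain m where "d = cyc m" using closed_walk_is_cyc by blast
  then show ?thesis using assms(2) d by (cases m) (auto simp: reduced_def cyc_Suc_right suffix_def)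
qed

text \<open>An orthonormality relation: multiplying by \<open>copath u q\<close> reads off a
  coefficient, which is how \<open>expands_coeff\<close> uses it.\<close>

lemma reduced_orth:
  assumes "(u, q) \<in> reduced" "(t, r) \<in> reduced"
  shows "copath u q * path t r = (if (u, q) = (t, r) then V v else 0)"
proof -
  have walk: "awalk u q v" "awalk t r v" using assms by (auto simp: reduced_def)
  then have vert: "u \<in> verts E" "t \<in> verts E" using awalk_hd_in_verts by auto
  consider "u \<noteq> t" | "u = t" "q = r" | "u = t" "q \<noteq> r" by blast
  then show ?thesis
  proof cases
    case 1
    then have "copath u q * (V u * path t r) = 0" using vert by (simp add: V_path_neq)
    then show ?thesis using 1 vert by (simp add: copath_V flip: mult.assoc)
  next
    case 2
    then show ?thesis using walk by (simp add: copath_path)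
  next
    case 3
    then have "\<not> prefix q r" "\<not> prefix r q" using reduced_prefix assms by blast+
    then show ?thesis using 3 copath_path_incomparable[OF walk(1)] walk(2) by simp
  qed
qed

text \<open>The coefficients are ordinary polynomials and stand on the right; they are zero outside
  \<open>D\<close> so that expansions add over the union of their supports.\<close>

definition expands :: "'r \<Rightarrow> ('v \<times> 'e list) set \<Rightarrow> ('v \<times> 'e list \<Rightarrow> 'k poly) \<Rightarrow> bool" where
  "expands x D p \<longleftrightarrow> finite D \<and> D \<subseteq> reduced \<and> (\<forall>d. d \<notin> D \<longrightarrow> p d = 0) \<and>
    x = (\<Sum>d\<in>D. path (fst d) (snd d) * ev (p d))"

lemma expands_add:
  assumes "expands x A p" "expands y B q"
  shows "expands (x + y) (A \<union> B) (\<lambda>d. p d + q d)"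
proof -
  have A: "finite A" "\<And>d. d \<notin> A \<Longrightarrow> p d = 0" and B: "finite B" "\<And>d. d \<notin> B \<Longrightarrow> q d = 0"
    using assms by (auto simp: expands_def)
  have "(\<Sum>d\<in>A. path (fst d) (snd d) * ev (p d)) = (\<Sum>d\<in>A \<union> B. path (fst d) (snd d) * ev (p d))"
    by (rule sum.mono_neutral_left) (use A B in auto)
  moreover have "(\<Sum>d\<in>B. path (fst d) (snd d) * ev (q d)) = (\<Sum>d\<in>A \<union> B. path (fst d) (snd d) * ev (q d))"
    by (rule sum.mono_neutral_left) (use A B in auto)
  ultimately show ?thesis
    using assms by (simp add: expands_def ev_add distrib_left sum.distrib)
qed

lemma expands_W:
  assumes "expands x D p"
  shows "expands (x * W n) D (\<lambda>d. p d * monom 1 n)"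
  using assms by (simp add: expands_def sum_distrib_right mult.assoc ev_W)

lemma expands_coeff:
  assumes "expands x D p" "(u, q) \<in> reduced"
  shows "copath u q * x = ev (p (u, q))"
proof -
  have D: "finite D" "D \<subseteq> reduced" "\<And>d. d \<notin> D \<Longrightarrow> p d = 0"
    "x = (\<Sum>d\<in>D. path (fst d) (snd d) * ev (p d))"
    using assms(1) by (auto simp: expands_def)
  have "copath u q * x = (\<Sum>d\<in>D. (copath u q * path (fst d) (snd d)) * ev (p d))"
    unfolding D(4) by (simp add: sum_distrib_left mult.assoc)
  also have "\<dots> = (\<Sum>d\<in>D. if d = (u, q) then ev (p d) else 0)"
  proof (rule sum.cong[OF refl])
    fix d assume "d \<in> D"
    then have "(fst d, snd d) \<in> reduced" using D(2) by auto
    from reduced_orth[OF assms(2) this]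
    show "copath u q * path (fst d) (snd d) * ev (p d) = (if d = (u, q) then ev (p d) else 0)"
      by (auto simp: V_ev)
  qed
  finally show ?thesis using D(1,3) by auto
qed

text \<open>A power of the cycle longer than the ghost path absorbs it and leaves a real path into
  \<open>v\<close>, from which copies of \<open>c\<close> are split off as a monomial. For a sum,
  each expansion is multiplied by the power used for the other one.\<close>

lemma ex_expands:
  assumes "b \<in> monomial_span"
  shows "\<exists>n D p. expands (b * W n) D p"
  using assms
proof induction
  case zero
  show ?case by (rule exI[of _ 0], rule exI[of _ "{}"], rule exI[of _ "\<lambda>_. 0"]) (simp add: expands_def)
next
  case (monomial u es w t fs k)
  show ?case
  proof (cases "t = v")
    case True
    obtain r where r: "cyc (Suc (length fs)) = fs @ r" "awalk w r v"
      using walk_extends_to_cyc[OF _ lessI] monomial(2) True by metis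
    obtain q m where q: "(u, q) \<in> reduced" "es @ r = q @ cyc m"
      using reduced_decomposition[of u "es @ r"] monomial(1) r(2) by (auto simp: awalk_append_ex)
    have "path u es * copath t fs * W (Suc (length fs)) = path u es * path w r"
      using copath_path_append[OF _ r(2)] monomial(2) True r(1) by (simp add: mult.assoc)
    also have "\<dots> = path u q * W m"
      using path_append[OF monomial(1), of r] path_append[of u q v "cyc m"] q by (simp add: reduced_def)
    finally have "C k * (path u es * copath t fs) * W (Suc (length fs)) = path u q * ev (monom k m)"
      by (simp add: ev_monom C_left_commute mult.assoc)
    then show ?thesis
      by (intro exI[of _ "Suc (length fs)"] exI[of _ "{(u, q)}"] exI[of _ "\<lambda>d. if d = (u, q) then monom k m else 0"])
        (use q in \<open>simp add: expands_def\<close>)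
  next
    case False
    then have "copath t fs * V v = 0"
      using copath_V_neq[of t v fs] awalk_hd_in_verts[OF monomial(2)] v_vert by simp
    then show ?thesis
      by (intro exI[of _ 0] exI[of _ "{}"] exI[of _ "\<lambda>_. 0"]) (simp add: expands_def mult.assoc)
  qed
next
  case (add x y)
  then obtain m A p n B q where "expands (x * W m) A p" "expands (y * W n) B q" by blast
  from expands_add[OF expands_W[OF this(1), of n] expands_W[OF this(2), of m]]
  have "expands ((x + y) * W (m + n)) (A \<union> B) (\<lambda>d. p d * monom 1 n + q d * monom 1 m)"
    by (simp add: mult.assoc W_mult distrib_right add.commute[of n m])
  then show ?case by blast
qed

text \<open>The coefficients of \<open>b * W n\<close> arise by multiplying an element of
  \<open>J\<close> with ghost paths, so they evaluate into \<open>J\<close> and \<open>f\<close>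
  divides them all. Then \<open>W' n\<close> undoes \<open>W n\<close>; it may pass
  \<open>ev f\<close> because the two commute.\<close>

lemma ideal_factor:
  assumes J: "alg_ideal J" and f: "\<And>p. ev p \<in> J \<Longrightarrow> f dvd p" and b: "b \<in> J"
  shows "\<exists>a\<in>alg. b * V v = a * ev f"
proof -
  have "b \<in> monomial_span" using alg_idealD(1)[OF J b] alg_subset_span by blast
  then obtain n D p where ex: "expands (b * W n) D p" using ex_expands by blast
  have mem: "b * W n \<in> J" using alg_idealD(4)[OF J W_in_alg b] .
  have D: "D \<subseteq> reduced" "b * W n = (\<Sum>d\<in>D. path (fst d) (snd d) * ev (p d))"
    using ex by (auto simp: expands_def)
  have "f dvd p d" if "d \<in> D" for d
  proof (rule f)
    have d: "(fst d, snd d) \<in> reduced" "awalk (fst d) (snd d) v"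
      using that D(1) by (auto simp: reduced_def)
    show "ev (p d) \<in> J"
      using expands_coeff[OF ex d(1)] alg_idealD(3)[OF J copath_in_alg[OF d(2)] mem] by simp
  qed
  then obtain g where g: "\<And>d. d \<in> D \<Longrightarrow> p d = g d * f" unfolding dvd_def by (metis mult.commute)
  define a where "a = (\<Sum>d\<in>D. path (fst d) (snd d) * ev (g d))"
  have "a \<in> alg"
    unfolding a_def
  proof (intro alg_sum alg.mult ev_in_alg)
    fix d assume "d \<in> D"
    then have "awalk (fst d) (snd d) v" using D(1) by (auto simp: reduced_def)
    then show "path (fst d) (snd d) \<in> alg" by (rule path_in_alg)
  qed
  moreover have "b * W n = a * ev f"
    unfolding D(2) a_def sum_distrib_right by (intro sum.cong refl) (simp add: g ev_mult mult.assoc)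
  then have "b * V v = a * W' n * ev f"
    using W_W'[of n] ev_W'_commute[of n f] by (metis mult.assoc)
  ultimately show ?thesis using alg.mult[OF _ W'_in_alg] by blast
qed

text \<open>In a product \<open>x * y\<close> one factor \<open>ev f\<close> is split off
  \<open>y\<close>. The remaining \<open>a\<close> is handed to \<open>x\<close>, and
  \<open>x * a\<close> stays in the lower power because that is an ideal; induction supplies the
  other factors.\<close>

lemma powers_factor:
  assumes J: "alg_ideal J" and f: "\<And>p. ev p \<in> J \<Longrightarrow> f dvd p" and b: "b \<in> powers J n"
  shows "\<exists>a\<in>alg. b * V v = a * ev (f ^ Suc n)"
  using b
proof (induction n arbitrary: b)
  case 0
  then show ?case using ideal_factor[OF J f] by simp
next
  case (Suc n)
  from Suc.prems have "b \<in> products (powers J n) J" by simp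
  then show ?case
  proof induction
    case (mult x y)
    obtain a where a: "a \<in> alg" "y * V v = a * ev f" using ideal_factor[OF J f mult(2)] by blast
    have "x * a \<in> powers J n" by (rule alg_idealD(4)[OF alg_ideal_powers[OF J] a(1) mult(1)])
    from Suc.IH[OF this] obtain a' where a': "a' \<in> alg" "x * a * V v = a' * ev (f ^ Suc n)" by blast
    have "x * y * V v = x * a * V v * ev f" using a(2) V_ev by (simp add: mult.assoc)
    also have "\<dots> = a' * ev (f ^ Suc (Suc n))"
      unfolding a'(2) by (simp only: mult.assoc power_Suc2 flip: ev_mult)
    finally show ?case using a'(1) by blast
  next
    case (add x y)
    then show ?case by (metis alg.add distrib_right)
  qed
qed

lemma intersection_meets_polynomials_trivially:
  assumes J: "alg_ideal J" "V v \<notin> J" and p: "\<And>n. ev p \<in> powers J n"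
  shows "coeff p 0 = 0"
proof (rule ccontr)
  assume p0: "coeff p 0 \<noteq> 0"
  have "\<exists>f. ev f \<in> J \<and> f \<noteq> 0" using p[of 0] p0 by auto
  then obtain f where f: "ev f \<in> J" "f \<noteq> 0" "\<And>g. ev g \<in> J \<Longrightarrow> g \<noteq> 0 \<Longrightarrow> degree f \<le> degree g"
    using ex_has_least_nat[of "\<lambda>f. ev f \<in> J \<and> f \<noteq> 0" _ degree] by blast
  have dvd: "f dvd g" if "ev g \<in> J" for g
  proof -
    \<comment> \<open>Remainder written with sums and products only, the operations under which
      \<open>alg_ideal\<close> is closed.\<close>
    have "g mod f = g + f * (- (g div f))"
      by (metis add_uminus_conv_diff minus_mult_div_eq_mod mult_minus_right)
    then have "ev (g mod f) = ev g + ev f * ev (- (g div f))" by (simp only: ev_add ev_mult)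
    then have "ev (g mod f) \<in> J"
      using alg_idealD(2)[OF J(1) that] alg_idealD(4)[OF J(1) ev_in_alg f(1)] by metis
    then show ?thesis using f(2,3) degree_mod_less[of f g] by (metis leD mod_0_imp_dvd)
  qed
  \<comment> \<open>A divisor inherits the nonzero constant term; this licenses the cancellation of
    \<open>monom 1 m\<close> below.\<close>
  have f0: "coeff f 0 \<noteq> 0"
    using dvd[OF p[of 0, simplified]] p0 by (auto elim!: dvdE simp: coeff_mult_0)
  have "f ^ Suc n dvd p" for n
  proof -
    obtain a where a: "a \<in> alg" "ev p * V v = a * ev (f ^ Suc n)"
      using powers_factor[OF J(1) dvd p] by blast
    obtain m D q where ex: "expands (a * W m) D q" using ex_expands a(1) alg_subset_span by blast
    \<comment> \<open>The factor \<open>V v\<close> on the left selects the coefficient at the empty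
      reduced walk.\<close>
    have "ev (p * monom 1 m) = V v * (ev p * V v) * W m" by (simp add: ev_W ev_V V_ev)
    also have "\<dots> = V v * (a * W m) * ev (f ^ Suc n)"
      unfolding a(2) by (simp add: mult.assoc ev_W_commute del: power_Suc)
    also have "\<dots> = ev (q (v, []) * f ^ Suc n)"
      using expands_coeff[OF ex reduced_Nil] by (simp add: ev_mult)
    finally have "p * monom 1 m = q (v, []) * f ^ Suc n" by (rule ev_inj)
    then have "f ^ Suc n dvd p * monom 1 m" by simp
    then show ?thesis using power_dvd_cancel_monom[OF f0] by blast
  qed
  \<comment> \<open>This exponent is already too large unless \<open>f\<close> is constant.\<close>
  then have "degree (f ^ Suc (degree p)) \<le> degree p" using p0 by (intro dvd_imp_degree_le) auto
  then have "Suc (degree p) * degree f \<le> degree p" using f(2) by (simp add: degree_power_eq del: power_Suc)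
  then have "degree f = 0" by (cases "degree f") auto
  then obtain k where k: "f = [:k:]" by (metis degree_eq_zeroE)
  then have "C k * V v \<in> J" using f(1) by (simp add: ev_pCons)
  then show False using vertex_from_multiple[OF J(1) v_vert] f(2) J(2) k by auto
qed

end

section \<open>The intersection of the powers in a Leavitt family\<close>

theorem (in leavitt_family) Inter_powers_eq_0:
  assumes J: "alg_ideal J" "\<And>w. w \<in> verts E \<Longrightarrow> V w \<notin> J" and x: "\<And>n. x \<in> powers J n"
  shows "x = 0"
proof (rule ccontr)
  assume "x \<noteq> 0"
  define I where "I = (\<Inter>n. powers J n)"
  have IJ: "I \<subseteq> J" unfolding I_def using powers.simps(1) by (metis INF_lower UNIV_I)
  note P = alg_idealD[OF alg_ideal_powers[OF J(1)]]
  have I: "alg_ideal I"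
    unfolding alg_ideal_def
  proof (intro conjI ballI)
    show "I \<subseteq> alg" using IJ alg_idealD(1)[OF J(1)] by blast
  qed (auto simp: I_def intro: P(2-4))
  have "x \<in> I" using x by (simp add: I_def)
  have "x \<in> monomial_span" using alg_idealD(1)[OF I \<open>x \<in> I\<close>] alg_subset_span by blast
  then obtain u w where uw: "u \<in> verts E" "w \<in> verts E" "V u * x * V w \<noteq> 0"
    using \<open>x \<noteq> 0\<close> nonzero_corner by blast
  obtain n where "ghost_bounded u n w (V u * x * V w)"
    using corner_ghost_bounded[OF \<open>x \<in> monomial_span\<close> uw(1,2)] by blast
  from real_reduction[OF this uw(3,2)] obtain t es where t: "awalk w es t"
    "V u * x * V w * path w es \<in> real_span u t" "V u * x * V w * path w es \<noteq> 0" by blast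
  have "V u * x * V w * path w es \<in> I"
    by (rule alg_idealD(4)[OF I path_in_alg[OF t(1)] alg_idealD(4)[OF I alg.V[OF uw(2)]
          alg_idealD(3)[OF I alg.V[OF uw(1)] \<open>x \<in> I\<close>]]])
  then obtain v0 G0 k0 h0 g0 where "closed_form I v0 G0 k0 h0 g0"
    using real_span_closed_form[OF I _ t(2,3)] by blast
  from exitless_closed_form[OF I _ this] IJ J(2) obtain v G k h g where cf: "closed_form I v G k h g" "G \<noteq> {}"
    "\<And>i es w. i \<in> G \<Longrightarrow> awalk v es w \<Longrightarrow> prefix es (g i @ es)"
    by (metis (no_types, lifting) subsetD)
  then have g: "\<And>i. i \<in> G \<Longrightarrow> awalk v (g i) v" "\<And>i. i \<in> G \<Longrightarrow> g i \<noteq> []" "v \<in> verts E" "k \<noteq> 0"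
    "finite G" "C k * V v + (\<Sum>i\<in>G. C (h i) * path v (g i)) \<in> I"
    by (auto simp: closed_form_def)
  obtain c where "exitless_cycle E C V S T v c"
    using obtain_exitless_cycle g(1,2) cf(2,3) by (metis all_not_in_conv)
  then interpret exitless_cycle E C V S T v c .
  have "\<exists>m. g i = cyc m \<and> m \<noteq> 0" if "i \<in> G" for i
    using closed_walk_is_cyc[OF g(1)[OF that]] g(2)[OF that] by (metis cyc_0)
  then obtain m where m: "\<And>i. i \<in> G \<Longrightarrow> g i = cyc (m i)" "\<And>i. i \<in> G \<Longrightarrow> m i \<noteq> 0" by metis
  \<comment> \<open>All exponents \<open>m i\<close> are positive, so \<open>k\<close> is the whole
    constant term.\<close>
  define p where "p = [:k:] + (\<Sum>i\<in>G. monom (h i) (m i))"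
  have "ev p = C k * V v + (\<Sum>i\<in>G. C (h i) * path v (g i))"
    unfolding p_def ev_add ev_sum by (simp add: ev_pCons ev_monom m(1))
  then have "ev p \<in> I" using g(6) by simp
  then have "ev p \<in> powers J n" for n by (simp add: I_def)
  then have "coeff p 0 = 0" by (rule intersection_meets_polynomials_trivially[OF J(1) J(2)[OF g(3)]])
  moreover have "coeff p 0 = k" using m(2) by (simp add: p_def coeff_sum) (intro sum.neutral, force)
  ultimately show False using g(4) by simp
qed

section \<open>Linear independence of paths\<close>

lemma poly_mapping_eq_sum_single:
  "p = (\<Sum>w\<in>Poly_Mapping.keys p. Poly_Mapping.single w (Poly_Mapping.lookup p w))"
  by (rule poly_mapping_eqI)
    (auto simp: lookup_sum lookup_single when_def in_keys_iff)

lemma poly_mapping_add_induct [case_names single add]: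
  fixes p :: "'a \<Rightarrow>\<^sub>0 'b::comm_monoid_add"
  assumes "\<And>w c. P (Poly_Mapping.single w c)" "\<And>p q. P p \<Longrightarrow> P q \<Longrightarrow> P (p + q)"
  shows "P p"
proof -
  \<comment> \<open>The empty sum is covered by a single term with coefficient 0.\<close>
  have "P (\<Sum>w\<in>A. Poly_Mapping.single w (Poly_Mapping.lookup p w))" for A
    using assms(1)[of undefined 0]
    by (induction A rule: infinite_finite_induct) (simp_all add: assms)
  then show ?thesis by (subst poly_mapping_eq_sum_single)
qed

section \<open>A representation by partial maps\<close>

definition linear_extension :: "('a \<Rightarrow> 'k::comm_ring_1) \<Rightarrow> ('a \<Rightarrow>\<^sub>0 'k) \<Rightarrow> 'k" where
  "linear_extension g p = (\<Sum>w\<in>Poly_Mapping.keys p. Poly_Mapping.lookup p w * g w)"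

lemma linear_extension_superset:
  "\<lbrakk>finite A; Poly_Mapping.keys p \<subseteq> A\<rbrakk> \<Longrightarrow> linear_extension g p = (\<Sum>w\<in>A. Poly_Mapping.lookup p w * g w)"
  unfolding linear_extension_def by (rule sum.mono_neutral_left) (auto simp: in_keys_iff)

lemma linear_extension_single: "linear_extension g (Poly_Mapping.single w c) = c * g w"
  by (simp add: linear_extension_superset[of "{w}"])

lemma linear_extension_add: "linear_extension g (p + q) = linear_extension g p + linear_extension g q"
proof -
  let ?A = "Poly_Mapping.keys p \<union> Poly_Mapping.keys q"
  show ?thesis
    by (simp add: linear_extension_superset[of ?A] keys_add lookup_add distrib_right sum.distrib)
qed

text \<open>The integer counts degrees, so that real paths of different lengths move a point to
  different places.\<close>

fun act :: "('v, 'e) pre_digraph \<Rightarrow> ('e \<Rightarrow> 'x \<Rightarrow> 'x) \<Rightarrow> ('v, 'e) generator \<Rightarrow>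
    'v \<times> 'x \<times> int \<Rightarrow> ('v \<times> 'x \<times> int) option" where
  "act E \<phi> (Vertex w) (v, s, d) = (if v = w then Some (v, s, d) else None)"
| "act E \<phi> (Edge e) (v, s, d) = (if v = head E e then Some (tail E e, \<phi> e s, d + 1) else None)"
| "act E \<phi> (Ghost e) (v, s, d) = (if v = tail E e \<and> s \<in> range (\<phi> e)
      then Some (head E e, inv_into UNIV (\<phi> e) s, d - 1) else None)"

primrec acts :: "('v, 'e) pre_digraph \<Rightarrow> ('e \<Rightarrow> 'x \<Rightarrow> 'x) \<Rightarrow> ('v, 'e) generator list \<Rightarrow>
    'v \<times> 'x \<times> int \<Rightarrow> ('v \<times> 'x \<times> int) option" where
  "acts E \<phi> [] x = Some x"
| "acts E \<phi> (g # gs) x = Option.bind (acts E \<phi> gs x) (act E \<phi> g)"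

lemma acts_append: "acts E \<phi> (us @ ws) x = Option.bind (acts E \<phi> ws x) (acts E \<phi> us)"
  by (induction us) (simp_all add: Option.bind_assoc)

text \<open>The algebra acts on functions from the right, by composition with partial maps; this
  needs no finiteness of supports.\<close>

definition rep :: "('v, 'e) pre_digraph \<Rightarrow> ('e \<Rightarrow> 'x \<Rightarrow> 'x) \<Rightarrow> ('v, 'e, 'k::field) free_alg \<Rightarrow>
    ('v \<times> 'x \<times> int \<Rightarrow> 'k) \<Rightarrow> 'v \<times> 'x \<times> int \<Rightarrow> 'k" where
  "rep E \<phi> p f x = linear_extension (\<lambda>w. case acts E \<phi> (letters w) x of None \<Rightarrow> 0 | Some y \<Rightarrow> f y) p"

lemma rep_single: "rep E \<phi> (Poly_Mapping.single w c) f x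
    = c * (case acts E \<phi> (letters w) x of None \<Rightarrow> 0 | Some y \<Rightarrow> f y)"
  by (simp add: rep_def linear_extension_single)

lemma rep_add: "rep E \<phi> (p + q) f x = rep E \<phi> p f x + rep E \<phi> q f x"
  by (simp add: rep_def linear_extension_add)

lemma rep_zero: "rep E \<phi> 0 f x = 0"
  by (simp add: rep_def linear_extension_def)

lemma rep_diff: "rep E \<phi> (p - q) f x = rep E \<phi> p f x - rep E \<phi> q f x"
  using rep_add[of E \<phi> "p - q" q f x] by simp

lemma rep_sum: "rep E \<phi> (sum p A) f x = (\<Sum>i\<in>A. rep E \<phi> (p i) f x)"
  by (induction A rule: infinite_finite_induct) (simp_all add: rep_add rep_zero)

lemma rep_fun_add: "rep E \<phi> p (\<lambda>x. f x + g x) x = rep E \<phi> p f x + rep E \<phi> p g x"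
  by (induction p rule: poly_mapping_add_induct)
    (simp_all add: rep_single rep_add distrib_left split: option.split)

lemma rep_fun_zero: "rep E \<phi> p (\<lambda>_. 0) x = 0"
  by (induction p rule: poly_mapping_add_induct) (simp_all add: rep_single rep_add split: option.split)

text \<open>Functions are pulled back along the partial maps, and pulling back reverses
  composition.\<close>

lemma rep_mult: "rep E \<phi> (p * q) f x = rep E \<phi> q (rep E \<phi> p f) x"
proof (induction p arbitrary: x rule: poly_mapping_add_induct)
  case (single u a)
  show ?case
    by (induction q rule: poly_mapping_add_induct)
      (simp_all add: rep_single rep_add distrib_left mult_single plus_word_def acts_append
        split: option.split)
next
  case (add p1 p2)
  have "rep E \<phi> (p1 + p2) f = (\<lambda>x. rep E \<phi> p1 f x + rep E \<phi> p2 f x)"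
    by (rule ext) (rule rep_add)
  then show ?case using add by (simp add: distrib_right rep_add rep_fun_add)
qed

lemma rep_gen: "rep E \<phi> (gen g) f x = (case act E \<phi> g x of None \<Rightarrow> 0 | Some y \<Rightarrow> f y)"
  by (simp add: gen_def rep_single)

text \<open>The fibres over all vertices are copies of one set, and an edge embeds the fibre at its
  head into the fibre at its tail. The axioms reflect, in this order, \<open>ghost_edge\<close>,
  \<open>ghost_edge_orth\<close> and \<open>regular\<close> among the relators.\<close>

locale branching_system =
  fixes E :: "('v, 'e) pre_digraph" and \<phi> :: "'e \<Rightarrow> 'x \<Rightarrow> 'x"
  assumes inj_branch: "e \<in> arcs E \<Longrightarrow> inj (\<phi> e)"
    and disjoint_branches: "\<lbrakk>e \<in> arcs E; f \<in> arcs E; tail E e = tail E f; \<phi> e s = \<phi> f t\<rbrakk> \<Longrightarrow> e = f"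
    and branches_cover: "regular_vertex E v \<Longrightarrow> \<exists>e\<in>out_arcs E v. s \<in> range (\<phi> e)"
begin

lemma rep_relator:
  assumes "p \<in> lpa_relators E"
  shows "rep E \<phi> p f (v, s, d) = 0"
  using assms
proof cases
  case (ghost_edge e)
  then show ?thesis
    using inj_branch[of e] by (simp add: rep_diff rep_mult rep_gen)
next
  case (ghost_edge_orth e e')
  then show ?thesis
    using disjoint_branches[of e' e] by (auto simp: rep_mult rep_gen)
next
  case (regular w)
  \<comment> \<open>This product acts as restriction to the branch of \<open>e\<close>; at a regular
    vertex the branches partition the fibre.\<close>
  have edge_ghost: "rep E \<phi> (edge e * ghost e) f (v, s, d)
      = (if v = tail E e \<and> s \<in> range (\<phi> e) then f (v, s, d) else 0)" for e
    by (simp add: rep_mult rep_gen f_inv_into_f)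
  show ?thesis
  proof (cases "v = w")
    case True
    obtain e where e: "e \<in> out_arcs E w" "s \<in> range (\<phi> e)"
      using branches_cover[OF regular(2)] by blast
    have single: "rep E \<phi> (edge e' * ghost e') f (v, s, d) = (if e' = e then f (v, s, d) else 0)"
      if "e' \<in> out_arcs E w" for e'
      unfolding edge_ghost using that e True disjoint_branches[of e e'] by auto
    have "(\<Sum>e\<in>out_arcs E w. rep E \<phi> (edge e * ghost e) f (v, s, d))
        = (\<Sum>e'\<in>out_arcs E w. if e' = e then f (v, s, d) else 0)"
      by (intro sum.cong refl single)
    also have "\<dots> = f (v, s, d)"
      using regular(2) e(1) by (simp add: regular_vertex_def)
    finally show ?thesis unfolding regular(1) by (simp add: rep_diff rep_sum rep_gen True)
  next
    case False
    then have "(\<Sum>e\<in>out_arcs E w. rep E \<phi> (edge e * ghost e) f (v, s, d)) = 0"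
      by (intro sum.neutral) (auto simp: edge_ghost)
    then show ?thesis unfolding regular(1) using False by (simp add: rep_diff rep_sum rep_gen)
  qed
qed (simp_all add: rep_diff rep_mult rep_gen)

lemma rep_lpa_ideal: "p \<in> lpa_ideal E \<Longrightarrow> rep E \<phi> p f x = 0"
proof (induction arbitrary: f x rule: lpa_ideal.induct)
  case (relator p)
  then show ?case by (cases x) (simp add: rep_relator)
next
  case (rmult p a)
  then have "rep E \<phi> p f = (\<lambda>_. 0)" by auto
  then show ?case by (simp add: rep_mult rep_fun_zero)
qed (simp_all add: rep_zero rep_add rep_mult)

lemma acts_walk:
  assumes "pre_digraph.cas E u es v"
  shows "acts E \<phi> (map Edge es) (v, s, d) = Some (u, foldr \<phi> es s, d + int (length es))"
  using assms
proof (induction es arbitrary: u)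
  case Nil
  then show ?case by (simp add: pre_digraph.cas.simps)
next
  case (Cons e es)
  then show ?case by (auto simp: pre_digraph.cas.simps)
qed

text \<open>Walks from the same vertex whose images meet begin with the same edge, since branches
  are disjoint; injectivity of that branch then removes it.\<close>

lemma foldr_branch_inj:
  assumes "set es \<subseteq> arcs E" "set fs \<subseteq> arcs E" "pre_digraph.cas E u es v" "pre_digraph.cas E u fs v"
    "length es = length fs" "foldr \<phi> es s = foldr \<phi> fs s"
  shows "es = fs"
  using assms(5,1-4,6)
proof (induction es fs arbitrary: u rule: list_induct2)
  case (Cons e es f fs)
  then have tails: "tail E e = tail E f" by (simp add: pre_digraph.cas.simps)
  have "\<phi> e (foldr \<phi> es s) = \<phi> f (foldr \<phi> fs s)" using Cons.prems by simp
  moreover from this have "e = f" using disjoint_branches[OF _ _ tails] Cons.prems by simp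
  ultimately have "foldr \<phi> es s = foldr \<phi> fs s"
    using inj_branch[of e] Cons.prems by (auto dest: injD)
  with Cons \<open>e = f\<close> show ?case by (auto simp: pre_digraph.cas.simps)
qed simp

lemma walks_independent_mod_lpa_ideal:
  fixes k :: "'e list \<Rightarrow> 'k::field"
  assumes "finite A" "\<And>es. es \<in> A \<Longrightarrow> pre_digraph.awalk E u es v"
    "(\<Sum>es\<in>A. Poly_Mapping.single (Word (Vertex u # map Edge es)) (k es)) \<in> lpa_ideal E" (is "?p \<in> _")
    and es: "es \<in> A"
  shows "k es = 0"
proof -
  fix s :: 'x
  \<comment> \<open>The indicator of the point to which \<open>es\<close> moves
    \<open>(v, s, 0)\<close>. Walks of another length miss this point by the degree, walks of the
    same length by \<open>foldr_branch_inj\<close>.\<close>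
  define f :: "'v \<times> 'x \<times> int \<Rightarrow> 'k" where
    "f y = (if y = (u, foldr \<phi> es s, int (length es)) then 1 else 0)" for y
  have "rep E \<phi> (Poly_Mapping.single (Word (Vertex u # map Edge fs)) (k fs)) f (v, s, 0)
      = (if fs = es then k es else 0)" if "fs \<in> A" for fs
    using foldr_branch_inj[of fs es u v s] assms(2)[OF that] assms(2)[OF es]
    by (auto simp: rep_single acts_walk f_def pre_digraph.awalk_def split: if_splits)
  then have "rep E \<phi> ?p f (v, s, 0) = k es"
    using assms(1) es by (simp add: rep_sum cong: sum.cong)
  then show ?thesis using rep_lpa_ideal[OF assms(3)] by metis
qed

end

text \<open>At a vertex of finite out-degree \<open>m\<close> the branches are the residue classes modulo \<open>m\<close> of the
  first coordinate; at an infinite emitter the edge is recorded in the list.\<close>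

lemma ex_branching_system:
  fixes E :: "('v, 'e) pre_digraph"
  shows "\<exists>\<phi> :: 'e \<Rightarrow> nat \<times> 'e list \<Rightarrow> nat \<times> 'e list. branching_system E \<phi>"
proof -
  have "\<exists>i :: 'e \<Rightarrow> nat. finite (out_arcs E v) \<longrightarrow> bij_betw i (out_arcs E v) {0..<card (out_arcs E v)}" for v
    using ex_bij_betw_finite_nat by blast
  then obtain i :: "'v \<Rightarrow> 'e \<Rightarrow> nat" where
    i: "\<And>v. finite (out_arcs E v) \<Longrightarrow> bij_betw (i v) (out_arcs E v) {0..<card (out_arcs E v)}"
    by metis
  define m where "m e = card (out_arcs E (tail E e))" for e
  define \<phi> where "\<phi> e = (\<lambda>(n, l). if finite (out_arcs E (tail E e))
      then (n * m e + i (tail E e) e, l) else (n, e # l))" for e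
  have less: "i (tail E e) e < m e" if "e \<in> arcs E" "finite (out_arcs E (tail E e))" for e
    using bij_betwE[OF i[OF that(2)]] that(1) by (auto simp: m_def)
  have "branching_system E \<phi>"
  proof
    fix e assume e: "e \<in> arcs E"
    show "inj (\<phi> e)" using less[OF e] by (auto simp: inj_def \<phi>_def)
  next
    fix e f s t assume ef: "e \<in> arcs E" "f \<in> arcs E" "tail E e = tail E f" "\<phi> e s = \<phi> f t"
    show "e = f"
    proof (cases "finite (out_arcs E (tail E e))")
      case True
      then have "fst s * m e + i (tail E e) e = fst t * m e + i (tail E e) f"
        using ef(3,4) by (simp add: \<phi>_def m_def case_prod_unfold)
      moreover have "i (tail E e) e < m e" "i (tail E e) f < m e"
        using less[OF ef(1)] less[OF ef(2)] True ef(3) by (simp_all add: m_def)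
      ultimately have "i (tail E e) e = i (tail E e) f"
        by (metis mod_less mod_mult_self3)
      then show ?thesis using bij_betw_imp_inj_on[OF i[OF True]] ef by (auto dest: inj_onD)
    next
      case False
      then show ?thesis using ef by (simp add: \<phi>_def case_prod_unfold)
    qed
  next
    fix v and s :: "nat \<times> 'e list" assume v: "regular_vertex E v"
    then have fin: "finite (out_arcs E v)" "card (out_arcs E v) > 0"
      by (simp_all add: regular_vertex_def card_gt_0_iff)
    then have "fst s mod card (out_arcs E v) \<in> i v ` out_arcs E v"
      using bij_betw_imp_surj_on[OF i[OF fin(1)]] by simp
    then obtain e where e: "e \<in> out_arcs E v" "i v e = fst s mod card (out_arcs E v)" by auto
    \<comment> \<open>Division by the out-degree: the remainder selects the edge and the quotient is
      the preimage.\<close>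
    then have "s = \<phi> e (fst s div card (out_arcs E v), snd s)"
      using fin by (simp add: \<phi>_def m_def prod_eq_iff)
    with e(1) show "\<exists>e\<in>out_arcs E v. s \<in> range (\<phi> e)" by blast
  qed
  then show ?thesis by blast
qed

section \<open>Presentation by generators and relations\<close>

text \<open>Constant terms are allowed here, so scalars become elements; \<open>lpa_ideal E\<close>
  is an ideal of this unital algebra too.\<close>

definition unitization :: "('v, 'e) pre_digraph \<Rightarrow> ('v, 'e, 'k::field) free_alg set" where
  "unitization E = {p. \<forall>w\<in>Poly_Mapping.keys p. set (letters w) \<subseteq> generators E}"

lemma unitization_add: "\<lbrakk>p \<in> unitization E; q \<in> unitization E\<rbrakk> \<Longrightarrow> p + q \<in> unitization E"
  using keys_add[of p q] by (auto simp: unitization_def)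

lemma unitization_uminus: "p \<in> unitization E \<Longrightarrow> - p \<in> unitization E"
  by (simp add: unitization_def)

lemma unitization_diff: "\<lbrakk>p \<in> unitization E; q \<in> unitization E\<rbrakk> \<Longrightarrow> p - q \<in> unitization E"
  using unitization_add[of p E "- q"] unitization_uminus[of q E] by simp

lemma unitization_mult: "\<lbrakk>p \<in> unitization E; q \<in> unitization E\<rbrakk> \<Longrightarrow> p * q \<in> unitization E"
  using keys_mult[of p q] by (fastforce simp: unitization_def plus_word_def)

lemma unitization_single: "set (letters w) \<subseteq> generators E \<Longrightarrow> Poly_Mapping.single w c \<in> unitization E"
  by (simp add: unitization_def)

lemma unitization_scalar: "Poly_Mapping.single 0 c \<in> unitization E"
  by (rule unitization_single) (simp add: zero_word_def)

lemma unitization_zero: "0 \<in> unitization E"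
  by (simp add: unitization_def)

lemma unitization_one: "1 \<in> unitization E"
  using unitization_scalar[of 1 E] by simp

lemma unitization_sum: "(\<And>i. i \<in> A \<Longrightarrow> p i \<in> unitization E) \<Longrightarrow> sum p A \<in> unitization E"
  by (induction A rule: infinite_finite_induct) (simp_all add: unitization_zero unitization_add)

lemma free_algebra_simps:
  "carrier (free_algebra E) = {p \<in> unitization E. 0 \<notin> Poly_Mapping.keys p}"
  "p \<otimes>\<^bsub>free_algebra E\<^esub> q = p * q" "p \<oplus>\<^bsub>free_algebra E\<^esub> q = p + q"
  by (auto simp: free_algebra_def unitization_def)

lemma carrier_unitization: "p \<in> carrier (free_algebra E) \<Longrightarrow> p \<in> unitization E"
  by (simp add: free_algebra_simps)

lemma scalar_central: "Poly_Mapping.single 0 c * (p :: ('v, 'e, 'k::field) free_alg) = p * Poly_Mapping.single 0 c"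
  by (induction p rule: poly_mapping_add_induct)
    (simp_all add: mult_single mult.commute[of c] distrib_left distrib_right)

lemma lpa_ideal_uminus: "p \<in> lpa_ideal E \<Longrightarrow> - p \<in> lpa_ideal E"
  using lpa_ideal.scale[of p E "- 1"] by (simp add: single_uminus)

lemma lpa_ideal_diff: "\<lbrakk>p \<in> lpa_ideal E; q \<in> lpa_ideal E\<rbrakk> \<Longrightarrow> p - q \<in> lpa_ideal E"
  using lpa_ideal.add[OF _ lpa_ideal_uminus] by fastforce

lemma unitization_split:
  assumes "a \<in> unitization E"
  obtains c b where "a = Poly_Mapping.single 0 c + b" "b \<in> carrier (free_algebra E)"
proof
  let ?c = "Poly_Mapping.lookup a 0"
  show "a = Poly_Mapping.single 0 ?c + (a - Poly_Mapping.single 0 ?c)" by simp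
  show "a - Poly_Mapping.single 0 ?c \<in> carrier (free_algebra E)"
    using unitization_diff[OF assms unitization_scalar] by (simp add: free_algebra_simps in_keys_iff lookup_minus)
qed

lemma lpa_ideal_unitization_mult:
  assumes "a \<in> unitization E" "p \<in> lpa_ideal E"
  shows "a * p \<in> lpa_ideal E" "p * a \<in> lpa_ideal E"
proof -
  obtain c b where a: "a = Poly_Mapping.single 0 c + b" "b \<in> carrier (free_algebra E)"
    using unitization_split[OF assms(1)] .
  show "a * p \<in> lpa_ideal E" "p * a \<in> lpa_ideal E"
    unfolding a(1) distrib_left distrib_right scalar_central[symmetric]
    using assms(2) a(2) by (auto intro: lpa_ideal.intros)
qed

lemma lpa_ideal_mult_cong:
  assumes "p \<in> unitization E" "q' \<in> unitization E" "p - p' \<in> lpa_ideal E" "q - q' \<in> lpa_ideal E"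
  shows "p * q - p' * q' \<in> lpa_ideal E"
proof -
  have "p * (q - q') + (p - p') * q' \<in> lpa_ideal E"
    using assms by (intro lpa_ideal.add lpa_ideal_unitization_mult)
  then show ?thesis by (simp add: algebra_simps)
qed

lemma lpa_ideal_trans: "\<lbrakk>p - q \<in> lpa_ideal E; q - r \<in> lpa_ideal E\<rbrakk> \<Longrightarrow> p - r \<in> lpa_ideal E"
  using lpa_ideal.add[of "p - q" E "q - r"] by simp

lemma lpa_ideal_sym: "p - q \<in> lpa_ideal E \<Longrightarrow> q - p \<in> lpa_ideal E"
  using lpa_ideal_uminus[of "p - q" E] by simp

section \<open>A ring type containing all Leavitt path algebras\<close>

text \<open>A type cannot depend on the graph. The product of the (unitized) Leavitt path algebras of
  all graphs over the given types, however, is a type, and it contains each of them as a factor.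
  This turns congruences modulo the relators into equations of a type class ring.\<close>

definition lpa_rel :: "(('v, 'e) pre_digraph \<Rightarrow> ('v, 'e, 'k::field) free_alg) \<Rightarrow>
    (('v, 'e) pre_digraph \<Rightarrow> ('v, 'e, 'k) free_alg) \<Rightarrow> bool" where
  "lpa_rel p q \<longleftrightarrow> (\<forall>E. p E \<in> unitization E \<and> q E \<in> unitization E \<and> p E - q E \<in> lpa_ideal E)"

quotient_type (overloaded) ('v, 'e, 'k) lpa_product =
  "('v, 'e) pre_digraph \<Rightarrow> ('v, 'e, 'k::field) free_alg" / partial: lpa_rel
proof (rule part_equivpI)
  show "\<exists>p :: ('v, 'e) pre_digraph \<Rightarrow> ('v, 'e, 'k) free_alg. lpa_rel p p"
    by (intro exI[of _ "\<lambda>_. 0"]) (simp add: lpa_rel_def unitization_zero lpa_ideal.zero)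
  show "symp (lpa_rel :: (('v, 'e) pre_digraph \<Rightarrow> ('v, 'e, 'k) free_alg) \<Rightarrow> _)"
    by (rule sympI, unfold lpa_rel_def) (metis lpa_ideal_sym)
  show "transp (lpa_rel :: (('v, 'e) pre_digraph \<Rightarrow> ('v, 'e, 'k) free_alg) \<Rightarrow> _)"
    by (rule transpI, unfold lpa_rel_def) (metis lpa_ideal_trans)
qed

instantiation lpa_product :: (type, type, field) "{ring, monoid_mult}"
begin

lift_definition zero_lpa_product :: "('a, 'b, 'c) lpa_product" is "\<lambda>_. 0"
  by (simp add: lpa_rel_def unitization_zero lpa_ideal.zero)

lift_definition one_lpa_product :: "('a, 'b, 'c) lpa_product" is "\<lambda>_. 1"
  by (simp add: lpa_rel_def unitization_one lpa_ideal.zero)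

lift_definition plus_lpa_product :: "('a, 'b, 'c) lpa_product \<Rightarrow> ('a, 'b, 'c) lpa_product \<Rightarrow> ('a, 'b, 'c) lpa_product"
  is "\<lambda>p q E. p E + q E"
  by (auto simp: lpa_rel_def unitization_add add_diff_add intro: lpa_ideal.add)

lift_definition uminus_lpa_product :: "('a, 'b, 'c) lpa_product \<Rightarrow> ('a, 'b, 'c) lpa_product"
  is "\<lambda>p E. - p E"
  by (simp add: lpa_rel_def unitization_uminus) (metis lpa_ideal_sym)

lift_definition minus_lpa_product :: "('a, 'b, 'c) lpa_product \<Rightarrow> ('a, 'b, 'c) lpa_product \<Rightarrow> ('a, 'b, 'c) lpa_product"
  is "\<lambda>p q E. p E - q E"
proof -
  fix p p' q q' :: "('a, 'b) pre_digraph \<Rightarrow> ('a, 'b, 'c) free_alg"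
  assume *: "lpa_rel p p'" "lpa_rel q q'"
  have "p E - q E - (p' E - q' E) = (p E - p' E) - (q E - q' E)" for E by simp
  then show "lpa_rel (\<lambda>E. p E - q E) (\<lambda>E. p' E - q' E)"
    using * unfolding lpa_rel_def by (metis unitization_diff lpa_ideal_diff)
qed

lift_definition times_lpa_product :: "('a, 'b, 'c) lpa_product \<Rightarrow> ('a, 'b, 'c) lpa_product \<Rightarrow> ('a, 'b, 'c) lpa_product"
  is "\<lambda>p q E. p E * q E"
  by (auto simp: lpa_rel_def unitization_mult intro: lpa_ideal_mult_cong)

instance
proof
  fix x y z :: "('a, 'b, 'c) lpa_product"
  show "x + y + z = x + (y + z)"
    by transfer (auto simp: lpa_rel_def add.assoc intro!: unitization_add lpa_ideal.zero)
  show "x + y = y + x"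
    by transfer (auto simp: lpa_rel_def add.commute intro!: unitization_add lpa_ideal.zero)
  show "0 + x = x"
    by transfer (auto simp: lpa_rel_def lpa_ideal.zero)
  show "- x + x = 0"
    by transfer (auto simp: lpa_rel_def unitization_zero lpa_ideal.zero)
  show "x - y = x + - y"
    by transfer (auto simp: lpa_rel_def lpa_ideal.zero intro!: unitization_diff)
  show "x * y * z = x * (y * z)"
    by transfer (auto simp: lpa_rel_def mult.assoc lpa_ideal.zero intro!: unitization_mult)
  show "(x + y) * z = x * z + y * z"
    by transfer (auto simp: lpa_rel_def distrib_right lpa_ideal.zero intro!: unitization_mult unitization_add)
  show "x * (y + z) = x * y + x * z"
    by transfer (auto simp: lpa_rel_def distrib_left lpa_ideal.zero intro!: unitization_mult unitization_add)
  show "1 * x = x" "x * 1 = x"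
    by (transfer, auto simp: lpa_rel_def lpa_ideal.zero)+
qed

end

lift_definition scalar :: "'k::field \<Rightarrow> ('v, 'e, 'k) lpa_product" is "\<lambda>c _. Poly_Mapping.single 0 c"
  by (simp add: lpa_rel_def unitization_scalar lpa_ideal.zero)

lemma scalar_rel: "lpa_rel (\<lambda>_. Poly_Mapping.single 0 c) (\<lambda>_. Poly_Mapping.single 0 c)"
  by (simp add: lpa_rel_def unitization_scalar lpa_ideal.zero)

lemma scalar_add: "scalar (a + b) = scalar a + scalar b"
  by (simp add: scalar.abs_eq plus_lpa_product.abs_eq scalar_rel single_add)

lemma scalar_mult: "scalar (a * b) = scalar a * scalar b"
  by (simp add: scalar.abs_eq times_lpa_product.abs_eq scalar_rel mult_single)

lemma scalar_one: "scalar 1 = 1"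
  by (simp add: scalar.abs_eq one_lpa_product.abs_eq)

lemma scalar_commute: "scalar a * x = x * scalar a"
proof (induction x rule: lpa_product.abs_induct)
  case (1 p)
  then show ?case by (simp add: scalar.abs_eq times_lpa_product.abs_eq scalar_rel scalar_central)
qed

text \<open>Inclusion of one factor, extended by 0. It does not send 1 to 1, so scalars are embedded
  separately, and diagonally, by \<open>scalar\<close>.\<close>

lift_definition factor :: "('v, 'e) pre_digraph \<Rightarrow> ('v, 'e, 'k::field) free_alg \<Rightarrow> ('v, 'e, 'k) lpa_product"
  is "\<lambda>E p F. if F = E \<and> p \<in> unitization E then p else 0"
  by (simp add: lpa_rel_def unitization_zero lpa_ideal.zero)

lemma factor_eq_iff:
  assumes "p \<in> unitization E" "q \<in> unitization E"
  shows "factor E p = factor E q \<longleftrightarrow> p - q \<in> lpa_ideal E"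
proof -
  let ?f = "\<lambda>p F. if F = E \<and> p \<in> unitization E then p else 0"
  have self: "lpa_rel (?f r) (?f r)" for r
    by (simp add: lpa_rel_def unitization_zero lpa_ideal.zero)
  have "lpa_rel (?f p) (?f q) \<longleftrightarrow> p - q \<in> lpa_ideal E"
  proof
    assume "lpa_rel (?f p) (?f q)"
    then have "?f p E - ?f q E \<in> lpa_ideal E" unfolding lpa_rel_def by blast
    then show "p - q \<in> lpa_ideal E" using assms by simp
  qed (simp add: lpa_rel_def assms unitization_zero lpa_ideal.zero)
  then show ?thesis
    unfolding factor.abs_eq using Quotient_rel[OF Quotient_lpa_product, of "?f p" "?f q"]
      self[of p] self[of q] by blast
qed

lemma factor_zero: "factor E 0 = 0"
  by transfer (auto simp: lpa_rel_def unitization_zero lpa_ideal.zero)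

lemma factor_eq_0_iff: "p \<in> unitization E \<Longrightarrow> factor E p = 0 \<longleftrightarrow> p \<in> lpa_ideal E"
  using factor_eq_iff[of p E 0] by (simp add: factor_zero unitization_zero)

lemma factor_add: "\<lbrakk>p \<in> unitization E; q \<in> unitization E\<rbrakk> \<Longrightarrow> factor E (p + q) = factor E p + factor E q"
  by transfer (auto simp: lpa_rel_def unitization_zero lpa_ideal.zero intro: unitization_add)

lemma factor_mult: "\<lbrakk>p \<in> unitization E; q \<in> unitization E\<rbrakk> \<Longrightarrow> factor E (p * q) = factor E p * factor E q"
  by transfer (auto simp: lpa_rel_def unitization_zero lpa_ideal.zero intro: unitization_mult)

lemma factor_scale:
  assumes p: "p \<in> unitization E"
  shows "factor E (Poly_Mapping.single 0 c * p) = scalar c * factor E p"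
proof -
  have eq: "(if F = E \<and> Poly_Mapping.single 0 c * p \<in> unitization E then Poly_Mapping.single 0 c * p else 0)
      = Poly_Mapping.single 0 c * (if F = E \<and> p \<in> unitization E then p else 0)" for F
    using unitization_mult[OF unitization_scalar p, of c] p by (cases "F = E") simp_all
  have "scalar c * factor E p
      = abs_lpa_product (\<lambda>F. Poly_Mapping.single 0 c * (if F = E \<and> p \<in> unitization E then p else 0))"
    unfolding scalar.abs_eq factor.abs_eq
    by (rule times_lpa_product.abs_eq)
      (simp_all add: eq_onp_def lpa_rel_def unitization_scalar unitization_zero lpa_ideal.zero)
  then show ?thesis unfolding factor.abs_eq eq by simp
qed

lemma factor_sum:
  "(\<And>i. i \<in> A \<Longrightarrow> p i \<in> unitization E) \<Longrightarrow> factor E (sum p A) = (\<Sum>i\<in>A. factor E (p i))"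
  by (induction A rule: infinite_finite_induct) (simp_all add: factor_zero factor_add unitization_sum)

lemma gen_unitization:
  "v \<in> verts E \<Longrightarrow> vtx v \<in> unitization E" "e \<in> arcs E \<Longrightarrow> edge e \<in> unitization E" "e \<in> arcs E \<Longrightarrow> ghost e \<in> unitization E"
  by (auto simp: gen_def generators_def intro!: unitization_single)

text \<open>The first letter is kept apart because \<open>factor E\<close> is not unital: it does
  not send the empty word to the empty product.\<close>

lemma factor_word:
  fixes E :: "('v, 'e) pre_digraph"
  assumes "set (g # gs) \<subseteq> generators E"
  shows "factor E (Poly_Mapping.single (Word (g # gs)) (1::'k::field))
    = factor E (gen g) * prod_list (map (\<lambda>g. factor E (gen g)) gs)"
  using assms
proof (induction gs arbitrary: g)
  case Nil
  then show ?case by (simp add: gen_def)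
next
  case (Cons h gs)
  have "Poly_Mapping.single (Word (g # h # gs)) 1
      = gen g * Poly_Mapping.single (Word (h # gs)) (1::'k)"
    by (simp add: gen_def mult_single plus_word_def)
  moreover have "(gen g :: ('v, 'e, 'k) free_alg) \<in> unitization E"
      "Poly_Mapping.single (Word (h # gs)) (1::'k) \<in> unitization E"
    using Cons.prems by (auto simp: gen_def intro!: unitization_single)
  ultimately show ?case using Cons by (simp add: factor_mult mult.assoc)
qed

text \<open>The \<open>itself\<close> parameter fixes the field, which the type of \<open>E\<close>
  does not determine.\<close>

locale lpa = wf_digraph E for E :: "('v, 'e) pre_digraph" +
  fixes field_type :: "'k::field itself"
begin

abbreviation "C \<equiv> scalar :: 'k \<Rightarrow> ('v, 'e, 'k) lpa_product"
abbreviation "V v \<equiv> factor E (vtx v) :: ('v, 'e, 'k) lpa_product"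
abbreviation "S e \<equiv> factor E (edge e) :: ('v, 'e, 'k) lpa_product"
abbreviation "T e \<equiv> factor E (ghost e) :: ('v, 'e, 'k) lpa_product"

lemma factor_relator:
  "\<lbrakk>p - q \<in> lpa_relators E; p \<in> unitization E; q \<in> unitization E\<rbrakk> \<Longrightarrow> factor E p = factor E q"
  by (simp add: factor_eq_iff lpa_ideal.relator)

lemma path_eq_factor:
  assumes "awalk u es v"
  shows "C c * (V u * prod_list (map S es)) = factor E (Poly_Mapping.single (Word (Vertex u # map Edge es)) c)"
    and "Poly_Mapping.single (Word (Vertex u # map Edge es)) c \<in> unitization E"
proof -
  have gens: "set (Vertex u # map Edge es) \<subseteq> generators E"
    using assms by (auto simp: awalk_def generators_def)
  show "Poly_Mapping.single (Word (Vertex u # map Edge es)) c \<in> unitization E" for c :: 'k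
    using gens by (intro unitization_single) simp
  then show "C c * (V u * prod_list (map S es)) = factor E (Poly_Mapping.single (Word (Vertex u # map Edge es)) c)"
    using factor_word[OF gens, where 'k = 'k] factor_scale[of "Poly_Mapping.single (Word (Vertex u # map Edge es)) 1" E c]
    by (simp add: mult_single comp_def)
qed

text \<open>The relations between generators come from the relators; independence comes from a
  branching system.\<close>

sublocale leavitt_family E C V S T
proof
  fix a b :: 'k and x :: "('v, 'e, 'k) lpa_product"
  show "C (a + b) = C a + C b" by (rule scalar_add)
  show "C (a * b) = C a * C b" by (rule scalar_mult)
  show "C 1 = 1" by (rule scalar_one)
  show "C a * x = x * C a" by (rule scalar_commute)
next
  fix v assume v: "v \<in> verts E"
  then show "V v * V v = V v"
    using factor_relator[OF lpa_relators.vertex_idem[OF v]]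
    by (simp add: gen_unitization unitization_mult factor_mult)
next
  fix v w assume vw: "v \<in> verts E" "w \<in> verts E" "v \<noteq> w"
  then show "V v * V w = 0"
    using lpa_ideal.relator[OF lpa_relators.vertex_orth[OF vw]]
    by (simp add: gen_unitization unitization_mult factor_eq_0_iff flip: factor_mult)
next
  fix e assume e: "e \<in> arcs E"
  show "V (tail E e) * S e = S e" using factor_relator[OF lpa_relators.source_edge[OF e]] e
    by (simp add: gen_unitization unitization_mult factor_mult)
  show "S e * V (head E e) = S e" using factor_relator[OF lpa_relators.edge_range[OF e]] e
    by (simp add: gen_unitization unitization_mult factor_mult)
  show "V (head E e) * T e = T e" using factor_relator[OF lpa_relators.range_ghost[OF e]] e
    by (simp add: gen_unitization unitization_mult factor_mult)
  show "T e * V (tail E e) = T e" using factor_relator[OF lpa_relators.ghost_source[OF e]] e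
    by (simp add: gen_unitization unitization_mult factor_mult)
  show "T e * S e = V (head E e)" using factor_relator[OF lpa_relators.ghost_edge[OF e]] e
    by (simp add: gen_unitization unitization_mult factor_mult)
next
  fix e f assume ef: "e \<in> arcs E" "f \<in> arcs E" "e \<noteq> f"
  then show "T e * S f = 0"
    using lpa_ideal.relator[OF lpa_relators.ghost_edge_orth[OF ef]]
    by (simp add: gen_unitization unitization_mult factor_eq_0_iff flip: factor_mult)
next
  fix v assume v: "regular_vertex E v"
  have "vtx v \<in> unitization E" using v by (simp add: regular_vertex_def gen_unitization)
  moreover have "edge e * ghost e \<in> unitization E" if "e \<in> out_arcs E v" for e
    using that by (simp add: gen_unitization unitization_mult)
  ultimately have "V v = factor E (\<Sum>e\<in>out_arcs E v. edge e * ghost e)"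
    by (intro factor_relator[OF lpa_relators.regular[OF v]] unitization_sum)
  also have "\<dots> = (\<Sum>e\<in>out_arcs E v. factor E (edge e * ghost e))"
    by (rule factor_sum) (simp add: gen_unitization unitization_mult)
  finally show "V v = (\<Sum>e\<in>out_arcs E v. S e * T e)"
    by (simp add: gen_unitization factor_mult)
next
  fix A :: "'e list set" and u v :: 'v and k :: "'e list \<Rightarrow> 'k" and es
  let ?w = "\<lambda>es. Poly_Mapping.single (Word (Vertex u # map Edge es)) (k es)"
  assume A: "finite A" "\<And>es. es \<in> A \<Longrightarrow> awalk u es v" "es \<in> A"
    and zero: "(\<Sum>es\<in>A. C (k es) * (V u * prod_list (map S es))) = 0"
  have "factor E (\<Sum>es\<in>A. ?w es) = 0"
    using zero path_eq_factor[OF A(2)] by (simp add: factor_sum)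
  then have "(\<Sum>es\<in>A. ?w es) \<in> lpa_ideal E"
    using path_eq_factor(2)[OF A(2)] by (simp add: factor_eq_0_iff unitization_sum)
  moreover obtain \<phi> :: "'e \<Rightarrow> nat \<times> 'e list \<Rightarrow> nat \<times> 'e list" where "branching_system E \<phi>"
    using ex_branching_system by blast
  ultimately show "k es = 0"
    using branching_system.walks_independent_mod_lpa_ideal[OF _ A(1,2) _ A(3)] by blast
qed

section \<open>Cosets, the quotient ring and its image in the ring type\<close>

abbreviation "F \<equiv> free_algebra E :: ('v, 'e, 'k) free_alg ring"
abbreviation "L \<equiv> leavitt_path_algebra E :: ('v, 'e, 'k) lpa ring"

definition coset :: "('v, 'e, 'k) free_alg \<Rightarrow> ('v, 'e, 'k) lpa" where
  "coset p = lpa_ideal E +>\<^bsub>F\<^esub> p"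

lemma coset_eq: "coset p = {h + p | h. h \<in> lpa_ideal E}"
  by (auto simp: coset_def a_r_coset_def' free_algebra_simps)

lemma mem_coset: "q \<in> coset p \<longleftrightarrow> q - p \<in> lpa_ideal E"
  by (auto simp: coset_eq) (metis diff_add_cancel)

lemma coset_eq_iff: "coset p = coset q \<longleftrightarrow> p - q \<in> lpa_ideal E"
proof
  assume "coset p = coset q"
  moreover have "p \<in> coset p" by (simp add: mem_coset lpa_ideal.zero)
  ultimately show "p - q \<in> lpa_ideal E" by (simp add: mem_coset)
next
  assume "p - q \<in> lpa_ideal E"
  then show "coset p = coset q"
    by (intro equalityI subsetI) (metis mem_coset lpa_ideal_trans lpa_ideal_sym)+
qed

lemma carrier_closed:
  "\<lbrakk>p \<in> carrier F; q \<in> carrier F\<rbrakk> \<Longrightarrow> p + q \<in> carrier F"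
  "\<lbrakk>p \<in> carrier F; q \<in> unitization E\<rbrakk> \<Longrightarrow> p * q \<in> carrier F"
  "\<lbrakk>p \<in> unitization E; q \<in> carrier F\<rbrakk> \<Longrightarrow> p * q \<in> carrier F"
  "p \<in> carrier F \<Longrightarrow> - p \<in> carrier F" "0 \<in> carrier F"
proof -
  \<comment> \<open>Hence a product can have a constant term only if both factors have one.\<close>
  have nil: "u + w = 0 \<Longrightarrow> u = 0 \<and> w = 0" for u w :: "('v, 'e) generator word"
    by (cases u; cases w) (simp add: plus_word_def zero_word_def)
  have prod: "0 \<notin> Poly_Mapping.keys (p * q)" if "0 \<notin> Poly_Mapping.keys p \<or> 0 \<notin> Poly_Mapping.keys q"
  proof
    assume "0 \<in> Poly_Mapping.keys (p * q)"
    then obtain u w where "u \<in> Poly_Mapping.keys p" "w \<in> Poly_Mapping.keys q" "u + w = 0"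
      using keys_mult[of p q] by auto
    then show False using that nil[of u w] by auto
  qed
  show "\<lbrakk>p \<in> carrier F; q \<in> unitization E\<rbrakk> \<Longrightarrow> p * q \<in> carrier F"
    "\<lbrakk>p \<in> unitization E; q \<in> carrier F\<rbrakk> \<Longrightarrow> p * q \<in> carrier F"
    using prod by (simp_all add: free_algebra_simps unitization_mult)
  show "\<lbrakk>p \<in> carrier F; q \<in> carrier F\<rbrakk> \<Longrightarrow> p + q \<in> carrier F"
    using keys_add[of p q] by (auto simp: free_algebra_simps unitization_add)
qed (simp_all add: free_algebra_simps unitization_uminus unitization_zero)

lemma gen_carrier: "g \<in> generators E \<Longrightarrow> gen g \<in> carrier F"
  by (auto simp: free_algebra_simps gen_def zero_word_def intro!: unitization_single)

lemma gens_carrier: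
  "v \<in> verts E \<Longrightarrow> vtx v \<in> carrier F" "e \<in> arcs E \<Longrightarrow> edge e \<in> carrier F"
  "e \<in> arcs E \<Longrightarrow> ghost e \<in> carrier F"
  by (auto simp: generators_def intro!: gen_carrier)

lemma carrier_diff: "\<lbrakk>p \<in> carrier F; q \<in> carrier F\<rbrakk> \<Longrightarrow> p - q \<in> carrier F"
  using carrier_closed(1)[of p "- q"] carrier_closed(4)[of q] by simp

lemma carrier_sum: "(\<And>i. i \<in> A \<Longrightarrow> p i \<in> carrier F) \<Longrightarrow> sum p A \<in> carrier F"
  by (induction A rule: infinite_finite_induct) (simp_all add: carrier_closed)

lemma lpa_ideal_carrier: "p \<in> lpa_ideal E \<Longrightarrow> p \<in> carrier F"
proof (induction rule: lpa_ideal.induct)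
  case (relator p)
  then show ?case
  proof cases
    case (regular v)
    show ?thesis unfolding regular(1)
      using regular(2)
      by (intro carrier_diff carrier_sum carrier_closed(2) gens_carrier gen_unitization)
        (auto simp: regular_vertex_def)
  qed (simp_all add: carrier_diff carrier_closed(2) gens_carrier gen_unitization)
next
  case (rmult p a)
  then show ?case using carrier_closed(2) carrier_unitization by blast
next
  case (lmult p a)
  then show ?case using carrier_closed(2) carrier_unitization by blast
qed (simp_all add: carrier_closed unitization_scalar)

lemma L_carrier: "carrier L = coset ` carrier F"
  by (auto simp: leavitt_path_algebra_def FactRing_def A_RCOSETS_def' coset_def a_r_coset_def')

lemma L_zero: "\<zero>\<^bsub>L\<^esub> = coset 0"
  by (auto simp: leavitt_path_algebra_def FactRing_def mem_coset)

text \<open>The product of cosets is a union of cosets over all representatives. They all agree, and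
  the union runs over nonempty sets, so it collapses.\<close>

lemma L_mult:
  assumes "p \<in> carrier F" "q \<in> carrier F"
  shows "coset p \<otimes>\<^bsub>L\<^esub> coset q = coset (p * q)"
proof -
  have hull: "x \<in> unitization E" if "x \<in> coset y" "y \<in> carrier F" for x y
  proof -
    have "x \<in> carrier F"
      using carrier_closed(1)[OF lpa_ideal_carrier that(2), of "x - y"] that(1) by (simp add: mem_coset)
    then show ?thesis by (rule carrier_unitization)
  qed
  have pq: "p \<in> unitization E" "q \<in> unitization E" using assms by (simp_all add: carrier_unitization)
  have same: "coset (x * y) = coset (p * q)" if "x \<in> coset p" "y \<in> coset q" for x y
    using that hull[OF that(1) assms(1)] pq
    by (simp add: coset_eq_iff mem_coset lpa_ideal_mult_cong)
  have "coset p \<otimes>\<^bsub>L\<^esub> coset q = (\<Union>x\<in>coset p. \<Union>y\<in>coset q. coset (x * y))"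
    by (simp add: leavitt_path_algebra_def FactRing_def rcoset_mult_def free_algebra_simps coset_def)
  also have "\<dots> = (\<Union>x\<in>coset p. \<Union>y\<in>coset q. coset (p * q))"
    by (intro SUP_cong refl same)
  also have "\<dots> = coset (p * q)"
  proof -
    have "p \<in> coset p" "q \<in> coset q" by (simp_all add: mem_coset lpa_ideal.zero)
    then show ?thesis by blast
  qed
  finally show ?thesis .
qed

lemma L_add: "coset p \<oplus>\<^bsub>L\<^esub> coset q = coset (p + q)"
proof -
  have "coset p \<oplus>\<^bsub>L\<^esub> coset q = {a + b | a b. a \<in> coset p \<and> b \<in> coset q}"
    by (auto simp: leavitt_path_algebra_def FactRing_def set_add_def' free_algebra_simps)
  also have "\<dots> = coset (p + q)"
  proof (intro equalityI subsetI)
    fix x assume "x \<in> {a + b | a b. a \<in> coset p \<and> b \<in> coset q}"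
    then obtain a b where ab: "x = a + b" "a - p \<in> lpa_ideal E" "b - q \<in> lpa_ideal E"
      by (auto simp: mem_coset)
    then show "x \<in> coset (p + q)" using lpa_ideal.add[OF ab(2,3)] by (simp add: mem_coset algebra_simps)
  next
    fix x assume "x \<in> coset (p + q)"
    then have "x - q \<in> coset p" "q \<in> coset q" "x = (x - q) + q"
      by (simp_all add: mem_coset lpa_ideal.zero algebra_simps)
    then show "x \<in> {a + b | a b. a \<in> coset p \<and> b \<in> coset q}" by blast
  qed
  finally show ?thesis .
qed

text \<open>Elements of the carrier have no constant term, so each of their words has a first letter
  and maps to a product of generators of \<open>alg\<close>.\<close>

lemma alg_eq: "alg = factor E ` carrier F"
proof (intro equalityI subsetI)
  fix x assume "x \<in> alg"
  then show "x \<in> factor E ` carrier F"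
  proof induction
    case zero
    show ?case using carrier_closed(5) factor_zero by (metis image_eqI)
  next
    case (add x y)
    then obtain p q where pq: "p \<in> carrier F" "q \<in> carrier F" "x = factor E p" "y = factor E q" by auto
    then have "x + y = factor E (p + q)" by (simp add: factor_add carrier_unitization)
    then show ?case using carrier_closed(1)[OF pq(1,2)] by blast
  next
    case (mult x y)
    then obtain p q where pq: "p \<in> carrier F" "q \<in> carrier F" "x = factor E p" "y = factor E q" by auto
    moreover have "q \<in> unitization E" using pq(2) by (rule carrier_unitization)
    ultimately have "x * y = factor E (p * q)" by (simp add: factor_mult carrier_unitization)
    then show ?case using carrier_closed(2)[OF pq(1) \<open>q \<in> unitization E\<close>] by blast
  next
    case (scale x k)
    then obtain p where p: "p \<in> carrier F" "x = factor E p" by auto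
    then have "C k * x = factor E (Poly_Mapping.single 0 k * p)" by (simp add: factor_scale carrier_unitization)
    then show ?case using carrier_closed(3)[OF unitization_scalar p(1)] by blast
  qed (auto intro: gens_carrier)
next
  have gen: "factor E (gen g) \<in> alg" if "g \<in> generators E" for g
    using that by (auto simp: generators_def intro: alg.intros)
  have word: "factor E (gen g) * prod_list (map (\<lambda>g. factor E (gen g)) gs) \<in> alg"
    if "set (g # gs) \<subseteq> generators E" for g gs
    using that
  proof (induction gs arbitrary: g)
    case (Cons h gs)
    then show ?case using alg.mult[OF gen[of g] Cons.IH[of h]] by simp
  qed (simp add: gen)
  fix x assume "x \<in> factor E ` carrier F"
  then obtain p where p: "p \<in> carrier F" "x = factor E p" by blast
  have single: "factor E (Poly_Mapping.single w c) \<in> alg \<and> Poly_Mapping.single w c \<in> unitization E"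
    if w: "w \<in> Poly_Mapping.keys p" for w c
  proof -
    have "w \<noteq> 0" "set (letters w) \<subseteq> generators E" using p w by (auto simp: free_algebra_def)
    then obtain g gs where g: "w = Word (g # gs)" "set (g # gs) \<subseteq> generators E"
      by (metis zero_word_def word.collapse list.exhaust)
    have one: "Poly_Mapping.single w 1 \<in> unitization E" using g by (simp add: unitization_single)
    have "factor E (Poly_Mapping.single w c) = C c * factor E (Poly_Mapping.single w 1)"
      using factor_scale[OF one, of c] by (simp add: mult_single)
    then show ?thesis
      using alg.scale[OF word[OF g(2)], of c] factor_word[OF g(2), where 'k = 'k] g by (simp add: unitization_single)
  qed
  have "x = (\<Sum>w\<in>Poly_Mapping.keys p. factor E (Poly_Mapping.single w (Poly_Mapping.lookup p w)))"
    unfolding p(2) by (subst poly_mapping_eq_sum_single) (simp add: factor_sum single)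
  then show "x \<in> alg" using single by (simp add: alg_sum)
qed

text \<open>Carries powers from cosets over to the ring type; the exponents differ by one because
  \<open>powers\<close> starts with the first power.\<close>

lemma ideal_power_factor:
  assumes I: "I \<subseteq> carrier L" "X \<in> ideal_power L I (Suc n)"
  shows "\<exists>p\<in>carrier F. X = coset p \<and> factor E p \<in> powers {factor E p | p. p \<in> carrier F \<and> coset p \<in> I} n"
  using I(2)
proof (induction n arbitrary: X)
  case 0
  then have "X \<in> I" by simp
  then obtain p where "p \<in> carrier F" "X = coset p" using I(1) by (auto simp: L_carrier)
  then show ?case using \<open>X \<in> I\<close> by (intro bexI[of _ p]) auto
next
  case (Suc n)
  let ?J = "{factor E p | p. p \<in> carrier F \<and> coset p \<in> I}"
  from Suc.prems have "X \<in> ideal_prod L (ideal_power L I (Suc n)) I" by simp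
  then show ?case
  proof induction
    case (prod i j)
    obtain p where p: "p \<in> carrier F" "i = coset p" "factor E p \<in> powers ?J n"
      using Suc.IH[OF prod(1)] by blast
    obtain q where q: "q \<in> carrier F" "j = coset q" using prod(2) I(1) by (auto simp: L_carrier)
    have "factor E (p * q) = factor E p * factor E q"
      using p q by (simp add: factor_mult carrier_unitization)
    moreover have "factor E q \<in> ?J" using q prod(2) by blast
    ultimately have "factor E (p * q) \<in> powers ?J (Suc n)" using p(3) by (simp add: products.mult)
    moreover have "p * q \<in> carrier F" using p q carrier_unitization carrier_closed(2) by blast
    ultimately show ?case using p q L_mult by blast
  next
    case (sum X Y)
    then obtain p q where p: "p \<in> carrier F" "X = coset p" "factor E p \<in> powers ?J (Suc n)"
      and q: "q \<in> carrier F" "Y = coset q" "factor E q \<in> powers ?J (Suc n)" by blast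
    have "factor E (p + q) = factor E p + factor E q"
      using p q by (simp add: factor_add carrier_unitization)
    then have "factor E (p + q) \<in> powers ?J (Suc n)" using p(3) q(3) by (simp add: products.add)
    then show ?case using p q L_add carrier_closed(1) by blast
  qed
qed

end

section \<open>Transfer to the Leavitt path algebra\<close>

theorem corollary3p8:
  fixes E :: "('v, 'e) pre_digraph"
    and I :: "('v, 'e, 'k::field) lpa set"
  assumes "wf_digraph E"
    and "two_sided_ideal I (leavitt_path_algebra E)"
    and "I \<noteq> carrier (leavitt_path_algebra E)"
  shows "(\<Inter>n\<in>{1..}. ideal_power (leavitt_path_algebra E) I n) = {\<zero>\<^bsub>leavitt_path_algebra E\<^esub>}
    \<longleftrightarrow> (\<forall>v\<in>verts E. lpa_vertex E v \<notin> I)"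
proof -
  interpret lpa E "TYPE('k)" using assms(1) by (simp add: lpa_def)
  have I_add: "additive_subgroup I L" and I_mult: "\<And>a x. a \<in> I \<Longrightarrow> x \<in> carrier L \<Longrightarrow> x \<otimes>\<^bsub>L\<^esub> a \<in> I \<and> a \<otimes>\<^bsub>L\<^esub> x \<in> I"
    using assms(2) by (auto simp: two_sided_ideal_def)
  note I = additive_subgroup.a_subset[OF I_add] additive_subgroup.a_closed[OF I_add]
    additive_subgroup.zero_closed[OF I_add]
  \<comment> \<open>Serves both directions: applied to a vertex, and to 0 in order to see that 0
    lies in the intersection.\<close>
  have idem: "coset p \<in> ideal_power L I (Suc n)" if "p \<in> carrier F" "coset p \<in> I" "coset (p * p) = coset p" for p n
    using that(2)
  proof (induction n)
    case (Suc n)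
    from ideal_prod.prod[OF Suc.IH[OF that(2)] that(2), of L] show ?case
      using L_mult[OF that(1,1)] that(3) by simp
  qed simp
  have vertex: "lpa_vertex E v = coset (vtx v)" for v by (simp add: lpa_vertex_def coset_def)
  show ?thesis
  proof
    assume Int: "(\<Inter>n\<in>{1..}. ideal_power L I n) = {\<zero>\<^bsub>L\<^esub>}"
    show "\<forall>v\<in>verts E. lpa_vertex E v \<notin> I"
    proof (intro ballI notI)
      fix v assume v: "v \<in> verts E" "lpa_vertex E v \<in> I"
      have "coset (vtx v * vtx v) = coset (vtx v)"
        using v(1) by (simp add: coset_eq_iff lpa_ideal.relator lpa_relators.vertex_idem)
      then have "coset (vtx v) \<in> ideal_power L I n" if "n \<ge> 1" for n
        using idem[of "vtx v" "n - 1"] v that by (simp add: gens_carrier vertex)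
      then have "coset (vtx v) = coset 0" using Int by (auto simp: L_zero)
      then have "V v = 0" using v(1) by (simp add: coset_eq_iff factor_eq_0_iff gen_unitization)
      then show False using V_nonzero[OF v(1)] by contradiction
    qed
  next
    assume no_vertex: "\<forall>v\<in>verts E. lpa_vertex E v \<notin> I"
    define J where "J = {factor E p | p. p \<in> carrier F \<and> coset p \<in> I}"
    have J: "alg_ideal J"
      unfolding alg_ideal_def
    proof (intro conjI ballI)
      show "J \<subseteq> alg" by (auto simp: J_def alg_eq)
    next
      fix x y assume "x \<in> J" "y \<in> J"
      then obtain p q where p: "p \<in> carrier F" "coset p \<in> I" "x = factor E p"
        and q: "q \<in> carrier F" "coset q \<in> I" "y = factor E q" by (auto simp: J_def)
      have "x + y = factor E (p + q)" using p q by (simp add: factor_add carrier_unitization)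
      moreover have "coset (p + q) \<in> I" using I(2)[OF p(2) q(2)] by (simp add: L_add)
      ultimately show "x + y \<in> J" using p q carrier_closed(1) unfolding J_def by blast
    next
      fix a x assume "a \<in> alg" "x \<in> J"
      then obtain p q where p: "p \<in> carrier F" "coset p \<in> I" "x = factor E p"
        and q: "q \<in> carrier F" "a = factor E q" by (auto simp: J_def alg_eq)
      have hull: "p \<in> unitization E" "q \<in> unitization E" using p q by (simp_all add: carrier_unitization)
      have "coset (q * p) \<in> I" "coset (p * q) \<in> I"
        using I_mult[OF p(2), of "coset q"] p q by (simp_all add: L_carrier L_mult)
      moreover have "q * p \<in> carrier F" "p * q \<in> carrier F" using p q hull carrier_closed(2) by blast+
      ultimately show "a * x \<in> J" "x * a \<in> J"
        using p q hull unfolding J_def by (auto simp flip: factor_mult)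
    qed
    have no_V: "V w \<notin> J" if w: "w \<in> verts E" for w
    proof
      assume "V w \<in> J"
      then obtain p where p: "p \<in> carrier F" "coset p \<in> I" "V w = factor E p" by (auto simp: J_def)
      then have "coset (vtx w) = coset p"
        using factor_eq_iff[of "vtx w" E p] w by (simp add: gen_unitization coset_eq_iff carrier_unitization)
      moreover have "coset (vtx w) \<notin> I" using no_vertex w by (simp flip: vertex)
      ultimately show False using p(2) by simp
    qed
    show "(\<Inter>n\<in>{1..}. ideal_power L I n) = {\<zero>\<^bsub>L\<^esub>}"
    proof (intro equalityI subsetI)
      fix X assume X: "X \<in> (\<Inter>n\<in>{1..}. ideal_power L I n)"
      then have "X \<in> ideal_power L I 1" by blast
      then have "X \<in> I" by simp
      then obtain p where p: "p \<in> carrier F" "X = coset p" using I(1) by (auto simp: L_carrier)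
      then have p_unitization: "p \<in> unitization E" using carrier_unitization by blast
      have "factor E p \<in> powers J n" for n
      proof -
        \<comment> \<open>Each power may supply another representative of \<open>X\<close>, but all
          of them have the same image under \<open>factor E\<close>.\<close>
        obtain q where q: "q \<in> carrier F" "X = coset q" "factor E q \<in> powers J n"
          using ideal_power_factor[OF I(1), of X n] X unfolding J_def by auto
        then have "factor E p = factor E q"
          using p by (simp add: factor_eq_iff p_unitization coset_eq_iff carrier_unitization)
        then show ?thesis using q(3) by simp
      qed
      with no_V have "factor E p = 0" by (rule Inter_powers_eq_0[OF J])
      then show "X \<in> {\<zero>\<^bsub>L\<^esub>}" using p(2) p_unitization by (simp add: L_zero coset_eq_iff factor_eq_0_iff)
    next
      fix X assume "X \<in> {\<zero>\<^bsub>L\<^esub>}"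
      then have X: "X = coset 0" by (simp add: L_zero)
      have "X \<in> ideal_power L I n" if "n \<ge> 1" for n
        using idem[of 0 "n - 1"] I(3) that X by (simp add: L_zero carrier_closed)
      then show "X \<in> (\<Inter>n\<in>{1..}. ideal_power L I n)" by auto
    qed
  qed
qed

end
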